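(* Let $L$ be an even hyperbolic lattice with fixed positive cone $\mathcal{P}_L$, let $G$ be a subgroup of $\mathrm{O}^+(L)$ of finite index, and let $\mathcal{V}\subset\mathcal{N}_L\cap L^\vee$ satisfy conditions (V1)–(V4) below. Then there exist only finitely many $G$-congruence classes of $\mathcal{V}^*$-chambers. (V1) There is $c>0$ with $-v^2<c$ for all $v\in\mathcal{V}$. (V2) $\mathcal{V}$ is $G$-invariant. (V3) Every $\mathcal{V}^*$-chamber has a finite defining set. (V4) For every $\mathcal{V}^*$-chamber $D$, every non-zero vector $x$ in the closure $\overline{D}$ of $D$ in $L\otimes\mathbb{R}$ with $x^2=0$ is a positive real multiple of a vector of $L$.
   Context: $L$ is an even hyperbolic lattice: a free $\mathbb{Z}$-module of finite rank $n>1$ with a non-degenerate even symmetric bilinear form $\langle\ ,\ \rangle$ of signature $(1,n-1)$, extended to $L\otimes\mathbb{R}$, $x^2=\langle x,x\rangle$. $L^\vee\subset L\otimes\mathbb{Q}$ is the dual lattice. $\mathcal{P}_L$ is one of the two connected components of $\{x: x^2>0\}$; $\mathrm{O}^+(L)$ is the group of isometries of $L$ preserving $\mathcal{P}_L$, acting on the right ($v\mapsto v^g$). $\mathcal{N}_L=\{v\in L\otimes\mathbb{R}: v^2<0\}$; for $v\in\mathcal{N}_L$, $(v)^\perp=\{x\in\mathcal{P}_L:\langle x,v\rangle=0\}$. For $\Delta\subset\mathcal{N}_L$, $\Sigma_L(\Delta)=\{x\in L\otimes\mathbb{R}:\langle x,v\rangle\ge0 \ \forall v\in\Delta\}$. Under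 (V1), the family $\{(v)^\perp: v\in\mathcal{V}\}$ is locally finite in $\mathcal{P}_L$, and a $\mathcal{V}^*$-chamber is the closure in $\mathcal{P}_L$ of a connected component of $\mathcal{P}_L\setminus\bigcup_{v\in\mathcal{V}}(v)^\perp$. A defining set of a $\mathcal{V}^*$-chamber $D$ is a subset $\Delta\subset\mathcal{N}_L\cap L^\vee$ with $D=\Sigma_L(\Delta)\cap\mathcal{P}_L$. Two $\mathcal{V}^*$-chambers $D,D'$ are $G$-congruent if $D'=D^g$ for some $g\in G$. *)

theory Defs
  imports "HOL-Analysis.Analysis"
begin

text \<open>The lattice L is modelled as the integer points of real^'n (fixing a Z-basis),
  with the bilinear form given by a Gram matrix Q; L tensor R is real^'n.\<close>

definition bform :: "real^'n^'n \<Rightarrow> real^'n \<Rightarrow> real^'n \<Rightarrow> real" where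
  "bform Q x y = x \<bullet> (Q *v y)"

definition lattice :: "(real^'n) set" where
  "lattice = {x. \<forall>i. x $ i \<in> \<int>}"

definition dual_lattice :: "real^'n^'n \<Rightarrow> (real^'n) set" where
  "dual_lattice Q = {x. \<forall>y\<in>lattice. bform Q x y \<in> \<int>}"

definition pos_inertia :: "real^'n^'n \<Rightarrow> nat" where
  "pos_inertia Q = Max {dim W | W :: (real^'n) set. subspace W \<and> (\<forall>x\<in>W. x \<noteq> 0 \<longrightarrow> bform Q x x > 0)}"

definition neg_inertia :: "real^'n^'n \<Rightarrow> nat" where
  "neg_inertia Q = Max {dim W | W :: (real^'n) set. subspace W \<and> (\<forall>x\<in>W. x \<noteq> 0 \<longrightarrow> bform Q x x < 0)}"

definition even_hyperbolic_lattice :: "real^'n^'n \<Rightarrow> bool" where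
  "even_hyperbolic_lattice Q \<longleftrightarrow>
     CARD('n) > 1 \<and>
     transpose Q = Q \<and>
     (\<forall>x\<in>lattice. \<forall>y\<in>lattice. bform Q x y \<in> \<int>) \<and>
     (\<forall>x\<in>lattice. \<exists>k::int. bform Q x x = 2 * of_int k) \<and>
     (\<forall>x. (\<forall>y. bform Q x y = 0) \<longrightarrow> x = 0) \<and>
     pos_inertia Q = 1 \<and> neg_inertia Q = CARD('n) - 1"

definition positive_cone :: "real^'n^'n \<Rightarrow> (real^'n) set \<Rightarrow> bool" where
  "positive_cone Q P \<longleftrightarrow> P \<in> components {x. bform Q x x > 0}"

definition ract :: "real^'n \<Rightarrow> real^'n^'n \<Rightarrow> real^'n" where
  "ract v g = v v* g"

definition orth_plus :: "real^'n^'n \<Rightarrow> (real^'n) set \<Rightarrow> (real^'n^'n) set" where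
  "orth_plus Q P = {g. (\<forall>i j. g $ i $ j \<in> \<int>) \<and> invertible g \<and>
      (\<forall>i j. matrix_inv g $ i $ j \<in> \<int>) \<and>
      (\<forall>x y. bform Q (ract x g) (ract y g) = bform Q x y) \<and>
      (\<lambda>x. ract x g) ` P = P}"

definition is_subgroup :: "(real^'n^'n) set \<Rightarrow> (real^'n^'n) set \<Rightarrow> bool" where
  "is_subgroup G H \<longleftrightarrow> G \<subseteq> H \<and> mat 1 \<in> G \<and>
     (\<forall>g\<in>G. \<forall>h\<in>G. g ** h \<in> G) \<and> (\<forall>g\<in>G. matrix_inv g \<in> G)"

definition finite_index :: "(real^'n^'n) set \<Rightarrow> (real^'n^'n) set \<Rightarrow> bool" where
  "finite_index G H \<longleftrightarrow> finite ((\<lambda>g. (\<lambda>h. h ** g) ` G) ` H)"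

definition neg_vectors :: "real^'n^'n \<Rightarrow> (real^'n) set" where
  "neg_vectors Q = {v. bform Q v v < 0}"

definition perp :: "real^'n^'n \<Rightarrow> (real^'n) set \<Rightarrow> real^'n \<Rightarrow> (real^'n) set" where
  "perp Q P v = {x\<in>P. bform Q x v = 0}"

definition Sigma_L :: "real^'n^'n \<Rightarrow> (real^'n) set \<Rightarrow> (real^'n) set" where
  "Sigma_L Q \<Delta> = {x. \<forall>v\<in>\<Delta>. bform Q x v \<ge> 0}"

definition chamber :: "real^'n^'n \<Rightarrow> (real^'n) set \<Rightarrow> (real^'n) set \<Rightarrow> (real^'n) set \<Rightarrow> bool" where
  "chamber Q P V D \<longleftrightarrow>
     (\<exists>C\<in>components (P - (\<Union>v\<in>V. perp Q P v)). D = P \<inter> closure C)"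

definition defining_set :: "real^'n^'n \<Rightarrow> (real^'n) set \<Rightarrow> (real^'n) set \<Rightarrow> (real^'n) set \<Rightarrow> bool" where
  "defining_set Q P D \<Delta> \<longleftrightarrow> \<Delta> \<subseteq> neg_vectors Q \<inter> dual_lattice Q \<and> D = Sigma_L Q \<Delta> \<inter> P"

definition congruent :: "(real^'n^'n) set \<Rightarrow> (real^'n) set \<Rightarrow> (real^'n) set \<Rightarrow> bool" where
  "congruent G D D' \<longleftrightarrow> (\<exists>g\<in>G. D' = (\<lambda>x. ract x g) ` D)"

definition congruence_classes ::
  "real^'n^'n \<Rightarrow> (real^'n) set \<Rightarrow> (real^'n) set \<Rightarrow> (real^'n^'n) set \<Rightarrow> (real^'n) set set set" where
  "congruence_classes Q P V G =
     (\<lambda>D. {D'. chamber Q P V D' \<and> congruent G D D'}) ` {D. chamber Q P V D}"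

end

(* Attach to x in P with x^2 = 1 its majorant 2<x,v>^2 - v^2, a positive definite form. If it is
   bounded below by mu > 0 on the non-zero dual vectors, then L has a basis that is short for it: for a basis
   reduced by greedy choice, the distance from the last basis vector to the span of the others is the
   inverse of the majorant norm of a dual vector. There are only finitely many Gram matrices of such bases,
   so all such x lie in O^+(L)-translates of one compact subset of P. A compact set meets
   only finitely many chambers, so it remains to find in every chamber a point x of this kind, with
   a uniform mu. Take a face of the chamber of minimal dimension, cut out by walls v in V. By
   minimality the chamber contains all of W \<inter> P, where W is the orthogonal complement of those v. A dual
   vector that is short for x in W has small, hence zero, product with each v, so it lies in W and
   is isotropic. If W is anisotropic, any x works. If W is a plane, its two isotropic rays are rational
   and x is chosen half-way between their primitive vectors. In higher dimension W has uncountably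
   many isotropic rays, contrary to (V4). *)

theory Submission
  imports Defs
begin

section \<open>Greedy reduction of lattice bases\<close>

text \<open>The quotient of the hyperboloid x^2 = 1 in P by O^+(L) need not be compact: along a
  sequence of points running into a cusp, some isotropic dual vectors become arbitrarily short. So
  an arbitrary point of a chamber is useless, and each chamber needs a point that stays away from
  the cusps by an amount depending only on \<open>disc\<close> and c. Passing to a minimal face
  serves two ends. All short dual vectors at a point of W are forced into W, and every isotropic
  direction of W is, up to sign, visible in the closure of the chamber, so that the rationality
  hypothesis can be applied to it. In the compactness argument the group element comes from
  comparing Gram matrices: if two lattice bases have the same products, the base change between them
  is already an isometry of L. It carries a point with bounded products against one basis to a point
  with the same products against the other, so one fixed basis for each Gram matrix is enough. The
  index of G enters only at the end, through finitely many coset representatives.\<close>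

definition int_span :: "'a::real_vector set \<Rightarrow> 'a set" where
  "int_span X = {\<Sum>b\<in>X. of_int (k b) *\<^sub>R b | k :: 'a \<Rightarrow> int. True}"

lemma int_span_insert:
  assumes "finite X" "b \<notin> X" "x - of_int m *\<^sub>R b \<in> int_span X"
  shows "x \<in> int_span (insert b X)"
proof -
  obtain k :: "'a \<Rightarrow> int" where k: "x - of_int m *\<^sub>R b = (\<Sum>b\<in>X. of_int (k b) *\<^sub>R b)"
    using assms(3) by (auto simp: int_span_def)
  have "(\<Sum>c\<in>insert b X. of_int ((k(b := m)) c) *\<^sub>R c) = of_int m *\<^sub>R b + (\<Sum>b\<in>X. of_int (k b) *\<^sub>R b)"
    using assms(1,2) by (simp add: sum.insert) (rule sum.cong, auto)
  also have "\<dots> = x" using k by (simp add: algebra_simps)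
  finally show ?thesis unfolding int_span_def by blast
qed

lemma span_insertE:
  assumes "x \<in> span (insert b X)"
  obtains t where "x - t *\<^sub>R b \<in> span X"
  using assms by (auto simp: span_insert)

text \<open>\<open>N\<close> stands for the majorant norm at a point that varies, so nothing may
  depend on a fixed norm. Discreteness of \<Lambda> enters through a positive lower bound for
  \<open>N\<close> given to the existence statements.\<close>

locale seminormed_group =
  fixes \<Lambda> :: "'a::euclidean_space set" and N :: "'a \<Rightarrow> real"
  assumes zero: "0 \<in> \<Lambda>"
    and diff: "x \<in> \<Lambda> \<Longrightarrow> y \<in> \<Lambda> \<Longrightarrow> x - y \<in> \<Lambda>"
    and triangle: "N (x + y) \<le> N x + N y"
    and scale: "N (a *\<^sub>R x) = \<bar>a\<bar> * N x"
begin

lemma nonneg: "N x \<ge> 0"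
  using triangle[of x "- x"] scale[of 0 x] scale[of "- 1" x] by simp

lemma minus: "x \<in> \<Lambda> \<Longrightarrow> - x \<in> \<Lambda>"
  using diff[OF zero, of x] by simp

lemma add: "x \<in> \<Lambda> \<Longrightarrow> y \<in> \<Lambda> \<Longrightarrow> x + y \<in> \<Lambda>"
  using diff[of x "- y"] minus[of y] by simp

lemma of_nat_scale: "x \<in> \<Lambda> \<Longrightarrow> real k *\<^sub>R x \<in> \<Lambda>"
  by (induction k) (auto simp: zero algebra_simps intro: add)

lemma of_int_scale: "x \<in> \<Lambda> \<Longrightarrow> of_int k *\<^sub>R x \<in> \<Lambda>"
  using of_nat_scale[of x "nat \<bar>k\<bar>"] minus[OF of_nat_scale[of x "nat \<bar>k\<bar>"]]
  by (cases "k \<ge> 0") auto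

text \<open>Instead of a minimum over \<open>\<Lambda> - span X\<close>, which would need discreteness of the projection,
  \<open>r\<close> is only a lower bound for the distances to \<open>span X\<close>; keeping everything proportional to \<open>r\<close>
  makes the triangle inequality sufficient.\<close>

definition reduced :: "'a set \<Rightarrow> real \<Rightarrow> real \<Rightarrow> bool" where
  "reduced X c r \<longleftrightarrow> finite X \<and> X \<subseteq> \<Lambda> \<and> independent X \<and> \<Lambda> \<inter> span X \<subseteq> int_span X \<and>
     (\<forall>b\<in>X. N b \<le> c * r) \<and> (\<forall>s\<in>span X. \<exists>l\<in>\<Lambda> \<inter> span X. N (s - l) \<le> c * r) \<and>
     r > 0 \<and> (\<forall>x\<in>\<Lambda> - span X. \<forall>s\<in>span X. r < N (x - s))"

lemma reduced_mono: "reduced X c r \<Longrightarrow> c \<le> c' \<Longrightarrow> reduced X c' r"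
  unfolding reduced_def by (meson less_imp_le mult_right_mono order_trans)

text \<open>The new constants come from two estimates. The norm of b and the new covering distance
  are at most (c + 1) * r, and lattice vectors outside the larger span stay 2r/3 - r/2 = r/6 away
  from it. Measured against r / 6, the factor becomes 6 * (c + 1). The last conclusion records the
  distance from b to the old span, which \<open>reduced\<close> does not retain.\<close>

lemma reduced_step:
  assumes red: "reduced X c r0" and c: "c \<ge> 0" and x: "x \<in> \<Lambda> - span X"
  obtains b r where "b \<notin> span X" "reduced (insert b X) (6 * (c + 1)) (r / 6)"
    "\<And>s. s \<in> span X \<Longrightarrow> 2 * r / 3 < N (b - s)"
proof -
  \<comment> \<open>A vector b within r of the span, where no lattice vector outside the span is within 2r/3, plays the role of
    a closest one: subtracting the rounded multiple of b leaves a distance at most r/2.\<close>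
  define near where "near \<rho> \<longleftrightarrow> (\<exists>y\<in>\<Lambda> - span X. \<exists>s\<in>span X. N (y - s) \<le> \<rho>)" for \<rho>
  have fin: "finite X" and XL: "X \<subseteq> \<Lambda>" and ind: "independent X" and int: "\<Lambda> \<inter> span X \<subseteq> int_span X"
    and Nb: "\<And>b. b \<in> X \<Longrightarrow> N b \<le> c * r0"
    and cov: "\<And>s. s \<in> span X \<Longrightarrow> \<exists>l\<in>\<Lambda> \<inter> span X. N (s - l) \<le> c * r0"
    and r0: "r0 > 0" and far: "\<And>\<rho>. near \<rho> \<Longrightarrow> r0 < \<rho>"
    using red by (auto simp: reduced_def near_def) (meson DiffI less_le_trans)
  have "near (N x)" using x span_zero by (force simp: near_def)
  then have R: "N x > r0" by (rule far)
  \<comment> \<open>The powers eventually fall below \<open>r0\<close>, so the sequence has a last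
    near term before the first one that is not. The ratio has to exceed 1/2, which is the loss
    caused by rounding to an integer.\<close>
  have "\<exists>j. \<not> near (N x * (2/3) ^ j)"
  proof -
    obtain j where "(2/3::real) ^ j < r0 / N x"
      using real_arch_pow_inv[of "r0 / N x" "2/3"] R r0 by auto
    then have "N x * (2/3) ^ j < r0" using R r0 by (simp add: field_simps)
    then show ?thesis using far by (metis less_asym)
  qed
  define j where "j = (LEAST j. \<not> near (N x * (2/3) ^ j))"
  have j: "\<not> near (N x * (2/3) ^ j)" unfolding j_def by (rule LeastI_ex) fact
  obtain i where i: "j = Suc i" using j \<open>near (N x)\<close> by (cases j) auto
  have "near (N x * (2/3) ^ i)" using not_less_Least[of i "\<lambda>j. \<not> near (N x * (2/3) ^ j)"] i unfolding j_def by simp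
  then obtain r where r: "near r" "\<not> near (2 * r / 3)"
    using j i by (intro that[of "N x * (2/3) ^ i"]) (auto simp: field_simps)
  have rr: "r0 < r" using far r by blast
  obtain y s where y: "y \<in> \<Lambda> - span X" "s \<in> span X" "N (y - s) \<le> r" using r by (auto simp: near_def)
  obtain l where l: "l \<in> \<Lambda>" "l \<in> span X" "N (s - l) \<le> c * r0" using cov[OF y(2)] by auto
  \<comment> \<open>Subtracting a lattice vector of the span that is close to s leaves the distance
    to the span as it is and brings the norm below r plus the covering bound.\<close>
  define b where "b = y - l"
  define p where "p = s - l"
  have bL: "b \<in> \<Lambda>" using y l by (auto simp: b_def diff)
  have bS: "b \<notin> span X" using y l unfolding b_def by (metis DiffD2 diff_add_cancel span_add)
  have pS: "p \<in> span X" using y l by (auto simp: p_def span_diff)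
  have bp: "N (b - p) \<le> r" using y by (simp add: b_def p_def)
  have cr: "c * r0 \<le> c * r" using c rr by (intro mult_left_mono) auto
  have Nbb: "N b \<le> (c + 1) * r"
    using triangle[of "y - s" "s - l"] y l cr by (simp add: b_def algebra_simps)
  have small: "N ((t - of_int (round t)) *\<^sub>R (b - p)) \<le> r / 2" for t
  proof -
    have "\<bar>t - of_int (round t)\<bar> \<le> 1/2" using of_int_round_abs_le[of t] by (simp add: abs_minus_commute)
    then have "\<bar>t - of_int (round t)\<bar> * N (b - p) \<le> 1/2 * r" using bp by (intro mult_mono) (auto simp: nonneg)
    then show ?thesis by (simp add: scale)
  qed
  have "reduced (insert b X) (6 * (c + 1)) (r / 6)"
    unfolding reduced_def
  proof (intro conjI ballI subsetI)
    fix z assume z: "z \<in> \<Lambda> \<inter> span (insert b X)"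
    then obtain t where t: "z - t *\<^sub>R b \<in> span X" by (auto elim: span_insertE)
    let ?u = "t - of_int (round t)" and ?y = "z - of_int (round t) *\<^sub>R b"
    have yL: "?y \<in> \<Lambda>" using z bL by (auto intro: diff of_int_scale)
    have "(z - t *\<^sub>R b) + ?u *\<^sub>R p \<in> span X" using t pS by (auto intro: span_add span_scale)
    moreover have "?y - ((z - t *\<^sub>R b) + ?u *\<^sub>R p) = ?u *\<^sub>R (b - p)" by (simp add: algebra_simps)
    moreover have "r / 2 \<le> 2 * r / 3" using rr r0 by simp
    ultimately have "?y \<in> span X"
      using r(2) yL small[of t] unfolding near_def by (metis DiffI order_trans)
    with yL int have "?y \<in> int_span X" by blast
    then show "z \<in> int_span (insert b X)"
      using fin bS span_base by (intro int_span_insert) auto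
  next
    fix s' assume "s' \<in> span (insert b X)"
    then obtain t where t: "s' - t *\<^sub>R b \<in> span X" by (auto elim: span_insertE)
    let ?u = "t - of_int (round t)"
    have "(s' - t *\<^sub>R b) + ?u *\<^sub>R p \<in> span X" using t pS by (auto intro: span_add span_scale)
    from cov[OF this] obtain l' where l': "l' \<in> \<Lambda>" "l' \<in> span X" "N ((s' - t *\<^sub>R b) + ?u *\<^sub>R p - l') \<le> c * r0" by auto
    have eq: "s' - (l' + of_int (round t) *\<^sub>R b) = ?u *\<^sub>R (b - p) + ((s' - t *\<^sub>R b) + ?u *\<^sub>R p - l')"
      by (simp add: algebra_simps)
    have "N (s' - (l' + of_int (round t) *\<^sub>R b)) \<le> r / 2 + c * r0"
      unfolding eq using small[of t] l'(3) triangle by (meson add_mono order_trans)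
    also have "\<dots> \<le> 6 * (c + 1) * (r / 6)" using cr rr r0 by (simp add: algebra_simps)
    finally have "N (s' - (l' + of_int (round t) *\<^sub>R b)) \<le> 6 * (c + 1) * (r / 6)" .
    moreover have "l' + of_int (round t) *\<^sub>R b \<in> \<Lambda> \<inter> span (insert b X)"
      using l' bL span_mono[of X "insert b X"]
      by (auto intro!: add of_int_scale span_add span_scale intro: span_base)
    ultimately show "\<exists>l\<in>\<Lambda> \<inter> span (insert b X). N (s' - l) \<le> 6 * (c + 1) * (r / 6)" by blast
  next
    fix x' s' assume x': "x' \<in> \<Lambda> - span (insert b X)" and s': "s' \<in> span (insert b X)"
    then obtain t where t: "s' - t *\<^sub>R b \<in> span X" by (auto elim: span_insertE)
    let ?u = "t - of_int (round t)" and ?y = "x' - of_int (round t) *\<^sub>R b"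
    have "?y \<in> \<Lambda>" using x' bL by (auto intro: diff of_int_scale)
    moreover have "?y \<notin> span X"
      using x' by (auto simp: span_insert)
    moreover have "(s' - t *\<^sub>R b) + ?u *\<^sub>R p \<in> span X" using t pS by (auto intro: span_add span_scale)
    ultimately have "2 * r / 3 < N (?y - ((s' - t *\<^sub>R b) + ?u *\<^sub>R p))"
      using r(2) unfolding near_def by (metis DiffI not_le)
    also have "?y - ((s' - t *\<^sub>R b) + ?u *\<^sub>R p) = (x' - s') + ?u *\<^sub>R (b - p)" by (simp add: algebra_simps)
    also have "N \<dots> \<le> N (x' - s') + r / 2" using triangle[of "x' - s'"] small[of t] by (meson add_left_mono order_trans)
    finally show "r / 6 < N (x' - s')" by simp
  next
    show "independent (insert b X)" using ind bS by (rule independent_insertI[rotated])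
  next
    fix b' assume "b' \<in> insert b X"
    then have "N b' \<le> (c + 1) * r" using Nb[of b'] Nbb cr rr r0 by (auto simp: algebra_simps)
    then show "N b' \<le> 6 * (c + 1) * (r / 6)" by (simp add: algebra_simps)
  qed (use fin XL bL rr r0 in auto)
  moreover have "2 * r / 3 < N (b - s')" if "s' \<in> span X" for s'
    using r(2) bL bS that unfolding near_def by (metis DiffI not_le)
  ultimately show thesis using bS that by blast
qed

text \<open>The factor 12 absorbs one step, because 6 * (c + 1) \<le> 12 * c as soon as c \<ge>
  1.\<close>

lemma reduced_exists:
  assumes sp: "span \<Lambda> = UNIV" and r0: "r0 > 0" "\<And>x. x \<in> \<Lambda> \<Longrightarrow> x \<noteq> 0 \<Longrightarrow> r0 < N x"
    and k: "k \<le> DIM('a)"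
  shows "\<exists>X r. card X = k \<and> reduced X (12 ^ k) r"
  using k
proof (induction k)
  case 0
  have "N 0 = 0" using scale[of 0 0] by simp
  then have "reduced {} 1 r0"
    using r0 zero by (auto simp: reduced_def int_span_def independent_empty)
  then show ?case by (intro exI[of _ "{}"] exI[of _ r0]) simp
next
  case (Suc k)
  then obtain X r where X: "card X = k" "reduced X (12 ^ k) r" by auto
  have "\<not> \<Lambda> \<subseteq> span X"
  proof
    assume "\<Lambda> \<subseteq> span X"
    then have "span X = UNIV" using sp by (metis span_minimal subspace_span top.extremum_uniqueI)
    then have "DIM('a) \<le> card X" using X by (metis dim_UNIV dim_le_card dim_span reduced_def span_superset)
    then show False using X Suc by simp
  qed
  then obtain x where "x \<in> \<Lambda> - span X" by blast
  with X(2) obtain b r' where b: "b \<notin> span X" "reduced (insert b X) (6 * (12 ^ k + 1)) (r' / 6)"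
    using reduced_step[of X "12 ^ k" r x] by (metis zero_le_numeral zero_le_power)
  have "(1::real) \<le> 12 ^ k" by simp
  then have "reduced (insert b X) (12 ^ Suc k) (r' / 6)"
    by (intro reduced_mono[OF b(2)]) simp
  moreover have "card (insert b X) = Suc k"
    using X b(1) span_base by (subst card_insert_disjoint) (auto simp: reduced_def)
  ultimately show ?case by blast
qed

text \<open>The last step is taken outside the induction: once X spans the whole space, the final
  clause of \<open>reduced\<close> is vacuous and no longer ties r to a distance. Here r is one
  sixth of the radius found in that step, so two thirds of that radius are 4 * r.\<close>

proposition reduced_basis:
  assumes sp: "span \<Lambda> = UNIV" and r0: "r0 > 0" "\<And>x. x \<in> \<Lambda> \<Longrightarrow> x \<noteq> 0 \<Longrightarrow> r0 < N x"
  obtains X b r where "finite X" "card X = DIM('a)" "X \<subseteq> \<Lambda>" "independent X" "\<Lambda> \<subseteq> int_span X"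
    "b \<in> X" "r > 0" "\<And>x. x \<in> X \<Longrightarrow> N x \<le> 12 ^ DIM('a) * r" "\<And>s. s \<in> span (X - {b}) \<Longrightarrow> 4 * r < N (b - s)"
proof -
  obtain k where k: "DIM('a) = Suc k" by (metis DIM_positive gr0_implies_Suc)
  obtain X r where X: "card X = k" "reduced X (12 ^ k) r"
    using reduced_exists[OF sp r0, of k] k by auto
  have "\<not> \<Lambda> \<subseteq> span X"
  proof
    assume "\<Lambda> \<subseteq> span X"
    then have "span X = UNIV" using sp by (metis span_minimal subspace_span top.extremum_uniqueI)
    then have "DIM('a) \<le> card X" using X by (metis dim_UNIV dim_le_card dim_span reduced_def span_superset)
    then show False using X k by simp
  qed
  then obtain x where "x \<in> \<Lambda> - span X" by blast
  with X(2) obtain b r' where b: "b \<notin> span X" "reduced (insert b X) (6 * (12 ^ k + 1)) (r' / 6)"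
      "\<And>s. s \<in> span X \<Longrightarrow> 2 * r' / 3 < N (b - s)"
    using reduced_step[of X "12 ^ k" r x] by (metis zero_le_numeral zero_le_power)
  have "(1::real) \<le> 12 ^ k" by simp
  then have red: "reduced (insert b X) (12 ^ DIM('a)) (r' / 6)"
    unfolding k by (intro reduced_mono[OF b(2)]) simp
  have bX: "b \<notin> X" using b(1) span_base by auto
  have card: "card (insert b X) = DIM('a)"
    using X bX k by (subst card_insert_disjoint) (auto simp: reduced_def)
  have "UNIV \<subseteq> span (insert b X)"
    using card red by (intro card_ge_dim_independent) (auto simp: reduced_def)
  then show thesis
    using red card b(3) bX
    by (intro that[of "insert b X" b "r' / 6"]) (auto simp: reduced_def)
qed

end

section \<open>The form, the positive cone and the majorant\<close>

lemma bform_add_left: "bform Q (x + y) z = bform Q x z + bform Q y z"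
  and bform_add_right: "bform Q x (y + z) = bform Q x y + bform Q x z"
  and bform_diff_left: "bform Q (x - y) z = bform Q x z - bform Q y z"
  and bform_diff_right: "bform Q x (y - z) = bform Q x y - bform Q x z"
  and bform_scale_left: "bform Q (a *\<^sub>R x) z = a * bform Q x z"
  and bform_scale_right: "bform Q x (a *\<^sub>R z) = a * bform Q x z"
  and bform_minus_left: "bform Q (- x) z = - bform Q x z"
  and bform_minus_right: "bform Q x (- z) = - bform Q x z"
  and bform_zero_left: "bform Q 0 z = 0"
  and bform_zero_right: "bform Q x 0 = 0"
  unfolding bform_def
  using matrix_vector_mult_scaleR[of Q "-1" z]
  by (simp_all add: inner_add_left inner_diff_left inner_add_right inner_diff_right
      matrix_vector_right_distrib matrix_vector_mult_diff_distrib matrix_vector_mult_scaleR)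

lemmas bform_simps = bform_add_left bform_add_right bform_diff_left bform_diff_right
  bform_scale_left bform_scale_right bform_minus_left bform_minus_right bform_zero_left bform_zero_right

lemma bform_ract: "bform Q (ract x g) (ract y g) = bform (g ** Q ** transpose g) x y"
proof -
  have "bform Q (x v* g) (transpose g *v y) = bform (g ** Q ** transpose g) x y"
    unfolding bform_def dot_lmul_matrix matrix_vector_mul_assoc matrix_mul_assoc ..
  then show ?thesis by (simp add: ract_def)
qed

lemma continuous_on_bform [continuous_intros]:
  fixes f g :: "'a::topological_space \<Rightarrow> real^'n"
  assumes "continuous_on S f" "continuous_on S g"
  shows "continuous_on S (\<lambda>x. bform Q (f x) (g x))"
  unfolding bform_def
  by (intro continuous_on_inner assms continuous_on_compose2[OF matrix_vector_mult_linear_continuous_on assms(2)]) auto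

lemma det_Ints: "(\<And>i j. A $ i $ j \<in> \<int>) \<Longrightarrow> det (A::real^'n^'n) \<in> \<int>"
  unfolding det_def by (intro Ints_sum Ints_mult Ints_prod) auto

lemma axis_lattice: "axis i 1 \<in> lattice"
  by (simp add: lattice_def axis_def)

lemma finite_vecs_in:
  assumes "finite T"
  shows "finite {x :: 'a^'n. \<forall>i. x $ i \<in> T}"
proof -
  have "vec_nth ` {x :: 'a^'n. \<forall>i. x $ i \<in> T} \<subseteq> UNIV \<rightarrow>\<^sub>E T" by auto
  then have "finite (vec_nth ` {x :: 'a^'n. \<forall>i. x $ i \<in> T})"
    by (elim finite_subset) (intro finite_PiE, auto simp: assms)
  then show ?thesis by (rule finite_imageD) (auto simp: inj_on_def vec_eq_iff)
qed

lemma finite_lattice_cball: "finite (lattice \<inter> cball (0::real^'n) r)"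
proof (rule finite_subset)
  show "lattice \<inter> cball (0::real^'n) r \<subseteq> {x. \<forall>i. x $ i \<in> {t \<in> \<int>. \<bar>t\<bar> \<le> r}}"
    using component_le_norm_cart order_trans by (fastforce simp: lattice_def)
qed (intro finite_vecs_in finite_abs_int_segment)

locale hyperbolic_cone =
  fixes Q :: "real^'n^'n" and P :: "(real^'n) set"
  assumes L: "even_hyperbolic_lattice Q"
    and P: "positive_cone Q P"
begin

abbreviation ip :: "real^'n \<Rightarrow> real^'n \<Rightarrow> real" where "ip \<equiv> bform Q"

section \<open>Consequences of the signature (1, n - 1)\<close>

lemma ip_commute: "ip x y = ip y x"
proof -
  have "ip x y = (transpose Q *v x) \<bullet> y" by (simp add: bform_def dot_lmul_matrix)
  also have "\<dots> = ip y x" using L by (simp add: even_hyperbolic_lattice_def bform_def inner_commute)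
  finally show ?thesis .
qed

lemma nondegenerate: "(\<And>y. ip x y = 0) \<Longrightarrow> x = 0"
  using L by (auto simp: even_hyperbolic_lattice_def)

lemma invertible_Q: "invertible Q"
proof -
  have "x = 0" if "Q *v x = 0" for x
    by (rule nondegenerate, subst ip_commute) (simp add: bform_def that)
  then show ?thesis by (simp add: invertible_left_inverse matrix_left_invertible_ker)
qed

text \<open>Needed to realise the coordinate functional of a lattice basis by a dual vector.\<close>

lemma represent_functional:
  assumes "linear (f :: real^'n \<Rightarrow> real)"
  obtains v where "\<And>x. f x = ip x v"
proof -
  obtain R where R: "Q ** R = mat 1" using invertible_Q by (auto simp: invertible_def)
  let ?w = "adjoint f 1"
  have "f x = ip x (R *v ?w)" for x
    using adjoint_works[OF assms, of x 1] R by (simp add: bform_def matrix_vector_mul_assoc)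
  then show thesis by (rule that)
qed

lemma dim_positive_le_1:
  assumes "subspace W" "\<And>x. x \<in> W \<Longrightarrow> x \<noteq> 0 \<Longrightarrow> ip x x > 0"
  shows "dim W \<le> 1"
proof -
  let ?S = "{dim W | W :: (real^'n) set. subspace W \<and> (\<forall>x\<in>W. x \<noteq> 0 \<longrightarrow> ip x x > 0)}"
  have "?S \<subseteq> {..DIM(real^'n)}" using dim_subset_UNIV by blast
  then have "finite ?S" by (rule finite_subset) simp
  moreover have "dim W \<in> ?S" using assms by blast
  moreover have "Max ?S = 1" using L by (simp add: even_hyperbolic_lattice_def pos_inertia_def)
  ultimately show ?thesis using Max_ge[of ?S "dim W"] by linarith
qed

text \<open>Otherwise x and y would span a positive definite plane.\<close>

lemma perp_nonpos:
  assumes x: "ip x x > 0" and xy: "ip x y = 0"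
  shows "ip y y \<le> 0"
proof (rule ccontr)
  assume y: "\<not> ip y y \<le> 0"
  let ?W = "span {x, y}"
  have "y \<notin> span {x}"
    using x y xy by (auto simp: span_singleton bform_simps)
  moreover have "x \<noteq> 0" using x by (auto simp: bform_simps)
  ultimately have "independent {y, x}" by (intro independent_insertI) (auto simp: independent_empty)
  moreover have "y \<noteq> x" using \<open>y \<notin> span {x}\<close> span_base by blast
  ultimately have "dim ?W = 2" by (simp add: insert_commute dim_eq_card_independent)
  moreover have "dim ?W \<le> 1"
  proof (rule dim_positive_le_1)
    fix w assume w: "w \<in> ?W" "w \<noteq> 0"
    then obtain a b where ab: "w = a *\<^sub>R x + b *\<^sub>R y"
      by (auto simp: span_insert[of x] span_singleton algebra_simps)
    have "ip w w = a\<^sup>2 * ip x x + b\<^sup>2 * ip y y"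
      using xy ip_commute[of x y] by (simp add: ab bform_simps power2_eq_square)
    moreover have "a \<noteq> 0 \<or> b \<noteq> 0" using w ab by auto
    ultimately show "ip w w > 0"
      using x y by (auto simp: add_pos_nonneg add_nonneg_pos)
  qed auto
  ultimately show False by simp
qed

text \<open>If y were isotropic, non-degeneracy would give a w orthogonal to x with non-zero product
  with y. The square of w + t y is then a non-constant affine function of t, and t is chosen to make
  it 1, against semi-negativity.\<close>

lemma perp_neg:
  assumes x: "ip x x > 0" and xy: "ip x y = 0" and "y \<noteq> 0"
  shows "ip y y < 0"
proof (rule ccontr)
  assume "\<not> ip y y < 0"
  then have y: "ip y y = 0" using perp_nonpos[OF x xy] by simp
  obtain z where z: "ip y z \<noteq> 0" using nondegenerate \<open>y \<noteq> 0\<close> by blast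
  define w where "w = z - (ip x z / ip x x) *\<^sub>R x"
  define t where "t = (1 - ip w w) / (2 * ip y w)"
  have yw: "ip y w \<noteq> 0" using z xy ip_commute[of x y] by (simp add: w_def bform_simps)
  have xw: "ip x w = 0" using x by (simp add: w_def bform_simps)
  have "ip (w + t *\<^sub>R y) (w + t *\<^sub>R y) \<le> 0"
    by (rule perp_nonpos[OF x]) (simp add: bform_simps xw xy)
  moreover have "ip (w + t *\<^sub>R y) (w + t *\<^sub>R y) = 1"
    using yw ip_commute[of y w] by (simp add: bform_simps y t_def)
  ultimately show False by simp
qed

lemma positive_not_orthogonal: "ip x x > 0 \<Longrightarrow> ip y y > 0 \<Longrightarrow> ip x y \<noteq> 0"
  by (metis perp_nonpos not_le)

text \<open>The combination of y and z that is orthogonal to x has square at most 0. Its two pure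
  terms are positive, so the mixed term has to outweigh them.\<close>

lemma same_side:
  assumes "ip x x > 0" "ip y y > 0" "ip z z > 0" "ip x y > 0" "ip x z > 0"
  shows "ip y z > 0"
proof -
  let ?u = "ip x z *\<^sub>R y - ip x y *\<^sub>R z"
  have "ip ?u ?u \<le> 0"
    by (rule perp_nonpos[OF assms(1)]) (simp add: bform_simps)
  moreover have "ip ?u ?u = (ip x z)\<^sup>2 * ip y y + (ip x y)\<^sup>2 * ip z z - 2 * ip x z * ip x y * ip y z"
    by (simp add: bform_simps ip_commute[of z y] power2_eq_square algebra_simps)
  moreover have "(ip x z)\<^sup>2 * ip y y > 0" "(ip x y)\<^sup>2 * ip z z > 0" using assms by auto
  ultimately have "(2 * ip x z * ip x y) * ip y z > 0" by linarith
  moreover have "2 * ip x z * ip x y > 0" using assms by simp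
  ultimately show ?thesis by (simp only: zero_less_mult_pos)
qed

definition half :: "real^'n \<Rightarrow> (real^'n) set" where
  "half x = {y. ip y y > 0 \<and> ip x y > 0}"

lemma convex_half:
  assumes x: "ip x x > 0"
  shows "convex (half x)"
proof (rule convexI)
  fix y z and u v :: real
  assume yz: "y \<in> half x" "z \<in> half x" and uv: "0 \<le> u" "0 \<le> v" "u + v = 1"
  then have pos: "ip y z > 0" using same_side[OF x] by (auto simp: half_def)
  have "ip (u *\<^sub>R y + v *\<^sub>R z) (u *\<^sub>R y + v *\<^sub>R z) = u\<^sup>2 * ip y y + v\<^sup>2 * ip z z + 2 * u * v * ip y z"
    by (simp add: bform_simps ip_commute[of z y] power2_eq_square algebra_simps)
  moreover have "u = 0 \<Longrightarrow> v > 0" "u \<ge> 0" using uv by auto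
  ultimately have "ip (u *\<^sub>R y + v *\<^sub>R z) (u *\<^sub>R y + v *\<^sub>R z) > 0"
    using yz pos uv by (cases "u = 0") (auto simp: half_def intro!: add_pos_nonneg)
  moreover have "ip x (u *\<^sub>R y + v *\<^sub>R z) > 0"
    using yz uv by (cases "u = 0") (auto simp: half_def bform_simps intro!: add_pos_nonneg)
  ultimately show "u *\<^sub>R y + v *\<^sub>R z \<in> half x" by (simp add: half_def)
qed

section \<open>The positive cone as an open convex cone\<close>

lemma P_component: "P \<in> components {x. ip x x > 0}"
  using P by (simp add: positive_cone_def)

lemma P_nonempty: "P \<noteq> {}"
  using P_component by (rule in_components_nonempty)

lemma P_pos: "x \<in> P \<Longrightarrow> ip x x > 0"
  using in_components_subset[OF P_component] by blast

lemma P_nonzero: "x \<in> P \<Longrightarrow> x \<noteq> 0"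
  using P_pos[of x] by (auto simp: bform_simps)

text \<open>Any point of the component describes it explicitly: \<open>half x\<close> is convex,
  hence connected, and conversely \<open>ip x\<close> has no zero on the connected set P.\<close>

lemma P_eq_half:
  assumes "x \<in> P"
  shows "P = half x"
proof
  have x: "ip x x > 0" using assms by (rule P_pos)
  show "half x \<subseteq> P"
    using convex_connected[OF convex_half[OF x]] assms x
    by (intro components_maximal[OF P_component]) (auto simp: half_def)
  have "connected ((\<lambda>y. ip x y) ` P)"
    by (intro connected_continuous_image continuous_intros in_components_connected[OF P_component])
  moreover have "0 \<notin> (\<lambda>y. ip x y) ` P" using positive_not_orthogonal[OF x] P_pos by force
  ultimately have "ip x y > 0" if "y \<in> P" for y
    using connectedD_interval[of "ip x ` P" "ip x y" "ip x x" 0] that assms x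
    by (meson image_eqI less_imp_le not_le)
  then show "P \<subseteq> half x" using P_pos by (auto simp: half_def)
qed

lemma P_mult_pos: "x \<in> P \<Longrightarrow> y \<in> P \<Longrightarrow> ip x y > 0"
  using P_eq_half[of x] unfolding half_def by blast

lemma P_I: "x \<in> P \<Longrightarrow> ip y y > 0 \<Longrightarrow> ip x y > 0 \<Longrightarrow> y \<in> P"
  using P_eq_half[of x] unfolding half_def by blast

lemma convex_P: "convex P"
proof -
  obtain x where x: "x \<in> P" using P_nonempty by blast
  show ?thesis using convex_half[OF P_pos[OF x]] unfolding P_eq_half[OF x, symmetric] .
qed

lemma open_P: "open P"
proof -
  have "open {x. ip x x > 0}" by (intro open_Collect_less continuous_intros)
  then show ?thesis using P_component by (rule open_components)
qed

lemma P_scale: "x \<in> P \<Longrightarrow> t > 0 \<Longrightarrow> t *\<^sub>R x \<in> P"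
  by (rule P_I[of x]) (auto simp: bform_simps P_pos)

lemma normalize:
  assumes "x \<in> P"
  shows "(1 / sqrt (ip x x)) *\<^sub>R x \<in> P" "ip ((1 / sqrt (ip x x)) *\<^sub>R x) ((1 / sqrt (ip x x)) *\<^sub>R x) = 1"
  using P_scale[OF assms] P_pos[OF assms] by (auto simp: bform_simps)

section \<open>Discriminant and integrality on the dual lattice\<close>

definition disc :: real where "disc = \<bar>det Q\<bar>"

lemma disc_pos: "disc > 0"
  using invertible_Q by (simp add: disc_def invertible_det_nz)

lemma lattice_subset_dual: "lattice \<subseteq> dual_lattice Q"
  using L by (auto simp: dual_lattice_def even_hyperbolic_lattice_def)

lemma Q_Ints: "Q $ i $ j \<in> \<int>"
proof -
  have "Q $ i $ j = ip (axis i 1) (axis j 1)"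
    by (simp add: bform_def inner_axis' matrix_vector_mul_component inner_axis)
  moreover have "(axis i 1 :: real^'n) \<in> lattice" "(axis j 1 :: real^'n) \<in> lattice"
    by (rule axis_lattice)+
  ultimately show ?thesis using L unfolding even_hyperbolic_lattice_def by metis
qed

text \<open>\<open>Q *v v\<close> has integral coordinates, and Cramer's rule recovers v from it
  with denominator \<open>det Q\<close>.\<close>

lemma disc_dual:
  assumes v: "v \<in> dual_lattice Q"
  shows "disc *\<^sub>R v \<in> lattice"
proof -
  have "(Q *v v) $ i = ip v (axis i 1)" for i
    by (subst ip_commute) (simp add: bform_def inner_axis')
  then have b: "(Q *v v) $ i \<in> \<int>" for i
    using v axis_lattice[of i] by (auto simp: dual_lattice_def)
  have d0: "det Q \<noteq> 0" using invertible_Q by (simp add: invertible_det_nz)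
  have "v = (\<chi> k. det (\<chi> i j. if j = k then (Q *v v) $ i else Q $ i $ j) / det Q)"
    by (rule cramer[THEN iffD1, OF d0 refl])
  from arg_cong[OF this, of "\<lambda>v. det Q * v $ _"]
  have eq: "det Q * v $ k = det (\<chi> i j. if j = k then (Q *v v) $ i else Q $ i $ j)" for k
    unfolding vec_lambda_beta times_divide_eq_right nonzero_mult_div_cancel_left[OF d0] .
  have "det Q * v $ k \<in> \<int>" for k
    unfolding eq by (rule det_Ints) (simp add: b Q_Ints)
  then show ?thesis by (auto simp: lattice_def disc_def abs_if)
qed

lemma dual_ip_Ints: "v \<in> dual_lattice Q \<Longrightarrow> w \<in> dual_lattice Q \<Longrightarrow> disc * ip v w \<in> \<int>"
  using disc_dual[of w] by (simp add: dual_lattice_def flip: bform_scale_right)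

text \<open>Products of dual vectors are quantised in steps of 1/disc; this is what turns "small"
  into "zero" later.\<close>

lemma dual_ip_ge:
  assumes "v \<in> dual_lattice Q" "w \<in> dual_lattice Q" "ip v w \<noteq> 0"
  shows "1 / disc \<le> \<bar>ip v w\<bar>"
  using Ints_nonzero_abs_ge1[OF dual_ip_Ints[OF assms(1,2)]] assms disc_pos
  by (simp add: field_simps abs_mult)

lemma finite_dual_cball: "finite (dual_lattice Q \<inter> cball 0 r)"
proof -
  have "(\<lambda>v. disc *\<^sub>R v) ` (dual_lattice Q \<inter> cball 0 r) \<subseteq> lattice \<inter> cball 0 (disc * r)"
    using disc_dual disc_pos by auto
  then have "finite ((\<lambda>v. disc *\<^sub>R v) ` (dual_lattice Q \<inter> cball 0 r))"
    using finite_lattice_cball finite_subset by blast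
  then show ?thesis by (rule finite_imageD) (use disc_pos in \<open>auto simp: inj_on_def\<close>)
qed

text \<open>For x^2 = 1 this is the positive definite majorant of Hermite and Siegel: the form with
  its sign reversed on the orthogonal complement of x.\<close>

definition majorant :: "real^'n \<Rightarrow> real^'n \<Rightarrow> real^'n \<Rightarrow> real" where
  "majorant x v w = 2 * ip x v * ip x w - ip v w"

lemma majorant_split:
  assumes "ip x x = 1"
  shows "ip (v - ip x v *\<^sub>R x) (v - ip x v *\<^sub>R x) \<le> 0"
    and "v \<noteq> ip x v *\<^sub>R x \<Longrightarrow> ip (v - ip x v *\<^sub>R x) (v - ip x v *\<^sub>R x) < 0"
    and "majorant x v v = (ip x v)\<^sup>2 - ip (v - ip x v *\<^sub>R x) (v - ip x v *\<^sub>R x)"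
    and "ip v v = (ip x v)\<^sup>2 + ip (v - ip x v *\<^sub>R x) (v - ip x v *\<^sub>R x)"
proof -
  have perp: "ip x (v - ip x v *\<^sub>R x) = 0" using assms by (simp add: bform_simps)
  show "ip (v - ip x v *\<^sub>R x) (v - ip x v *\<^sub>R x) \<le> 0"
    using perp_nonpos[OF _ perp] assms by simp
  show "v \<noteq> ip x v *\<^sub>R x \<Longrightarrow> ip (v - ip x v *\<^sub>R x) (v - ip x v *\<^sub>R x) < 0"
    using perp_neg[OF _ perp] assms by simp
  show "majorant x v v = (ip x v)\<^sup>2 - ip (v - ip x v *\<^sub>R x) (v - ip x v *\<^sub>R x)"
    "ip v v = (ip x v)\<^sup>2 + ip (v - ip x v *\<^sub>R x) (v - ip x v *\<^sub>R x)"
    using assms by (simp_all add: majorant_def bform_simps power2_eq_square ip_commute[of v x])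
qed

lemma majorant_ge:
  assumes "ip x x = 1"
  shows "(ip x v)\<^sup>2 \<le> majorant x v v" "\<bar>ip v v\<bar> \<le> majorant x v v" "majorant x v v \<ge> 0"
proof -
  show "(ip x v)\<^sup>2 \<le> majorant x v v" "\<bar>ip v v\<bar> \<le> majorant x v v"
    using majorant_split(1,3,4)[OF assms, of v] zero_le_power2[of "ip x v"] by linarith+
  then show "majorant x v v \<ge> 0" by linarith
qed

lemma majorant_pos:
  assumes "ip x x = 1" "v \<noteq> 0"
  shows "majorant x v v > 0"
proof (cases "v = ip x v *\<^sub>R x")
  case True
  then have "ip x v \<noteq> 0" using assms by force
  then have "(ip x v)\<^sup>2 > 0" by simp
  then show ?thesis using majorant_ge(1)[OF assms(1), of v] by linarith
next
  case False
  then show ?thesis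
    using majorant_split(2,3)[OF assms(1), of v] zero_le_power2[of "ip x v"] by linarith
qed

lemma majorant_simps:
  "majorant x (v + v') w = majorant x v w + majorant x v' w"
  "majorant x v (w + w') = majorant x v w + majorant x v w'"
  "majorant x (v - v') w = majorant x v w - majorant x v' w"
  "majorant x v (w - w') = majorant x v w - majorant x v w'"
  "majorant x (a *\<^sub>R v) w = a * majorant x v w"
  "majorant x v (a *\<^sub>R w) = a * majorant x v w"
  by (simp_all add: majorant_def bform_simps algebra_simps)

lemma majorant_commute: "majorant x v w = majorant x w v"
  by (simp add: majorant_def ip_commute[of v w])

definition mnorm :: "real^'n \<Rightarrow> real^'n \<Rightarrow> real" where
  "mnorm x v = sqrt (majorant x v v)"

lemma mnorm_sq: "ip x x = 1 \<Longrightarrow> (mnorm x v)\<^sup>2 = majorant x v v"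
  by (simp add: mnorm_def majorant_ge)

lemma mnorm_nonneg: "ip x x = 1 \<Longrightarrow> mnorm x v \<ge> 0"
  by (simp add: mnorm_def majorant_ge)

lemma mnorm_pos: "ip x x = 1 \<Longrightarrow> v \<noteq> 0 \<Longrightarrow> mnorm x v > 0"
  by (simp add: mnorm_def majorant_pos)

lemma majorant_Cauchy_Schwarz:
  assumes x: "ip x x = 1"
  shows "\<bar>majorant x v w\<bar> \<le> mnorm x v * mnorm x w"
proof (cases "w = 0")
  case True
  then show ?thesis using majorant_simps(6)[of x v 0 w] by (simp add: mnorm_def majorant_def bform_simps)
next
  case False
  then have w: "majorant x w w > 0" using majorant_pos[OF x] by simp
  define t where "t = majorant x v w / majorant x w w"
  have "0 \<le> majorant x (v - t *\<^sub>R w) (v - t *\<^sub>R w)" using majorant_ge[OF x] by simp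
  also have "\<dots> = majorant x v v - 2 * t * majorant x v w + t * t * majorant x w w"
    by (simp add: majorant_simps majorant_commute[of x w v] algebra_simps)
  also have "t * t * majorant x w w = t * majorant x v w" using w by (simp add: t_def)
  finally have "t * majorant x v w \<le> majorant x v v" by simp
  then have "(majorant x v w)\<^sup>2 \<le> (mnorm x v * mnorm x w)\<^sup>2"
    using w by (simp add: t_def power_mult_distrib mnorm_sq[OF x] power2_eq_square[of "majorant x v w"] field_simps)
  then show ?thesis using mnorm_nonneg[OF x] by (simp add: abs_le_square_iff[symmetric] abs_mult)
qed

lemma mnorm_triangle:
  assumes x: "ip x x = 1"
  shows "mnorm x (v + w) \<le> mnorm x v + mnorm x w"
proof (rule power2_le_imp_le)
  have "(mnorm x (v + w))\<^sup>2 = (mnorm x v)\<^sup>2 + (mnorm x w)\<^sup>2 + 2 * majorant x v w"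
    by (simp add: mnorm_sq[OF x] majorant_simps majorant_commute[of x w v])
  also have "\<dots> \<le> (mnorm x v + mnorm x w)\<^sup>2"
    using majorant_Cauchy_Schwarz[OF x, of v w] by (simp add: power2_sum)
  finally show "(mnorm x (v + w))\<^sup>2 \<le> (mnorm x v + mnorm x w)\<^sup>2" .
qed (simp add: mnorm_nonneg[OF x])

lemma mnorm_scale: "mnorm x (a *\<^sub>R v) = \<bar>a\<bar> * mnorm x v"
  by (simp add: mnorm_def majorant_simps real_sqrt_mult flip: mult.assoc)

text \<open>For x^2 = 1, the isometry that fixes x and is -1 on its orthogonal complement. It
  converts between \<open>ip\<close> and \<open>majorant\<close>.\<close>

definition flip :: "real^'n \<Rightarrow> real^'n \<Rightarrow> real^'n" where
  "flip x v = (2 * ip x v) *\<^sub>R x - v"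

lemma majorant_flip: "majorant x v w = ip w (flip x v)"
  by (simp add: majorant_def flip_def bform_simps ip_commute[of w])

lemma mnorm_flip: "ip x x = 1 \<Longrightarrow> mnorm x (flip x v) = mnorm x v"
  by (simp add: mnorm_def majorant_def flip_def bform_simps ip_commute[of v x])

text \<open>Cauchy-Schwarz for the majorant, applied to \<open>flip x w\<close>, which has the same
  majorant norm as w.\<close>

lemma ip_bound:
  assumes x: "ip x x = 1"
  shows "\<bar>ip v w\<bar> \<le> mnorm x v * mnorm x w"
proof -
  have "ip v w = majorant x (flip x w) v"
    using x by (simp add: majorant_def flip_def bform_simps ip_commute[of w])
  then show ?thesis using majorant_Cauchy_Schwarz[OF x, of "flip x w" v] mnorm_flip[OF x]
    by (simp add: mult.commute)
qed

end

section \<open>Points whose majorant is bounded below\<close>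

lemma matrix_inv_eqI:
  fixes A B :: "real^'n^'n"
  assumes "B ** A = mat 1"
  shows "matrix_inv A = B"
proof -
  have "A ** B = mat 1" using assms by (simp add: matrix_left_right_inverse)
  then have "A ** matrix_inv A = mat 1"
    using someI[of "\<lambda>A'. A ** A' = mat 1 \<and> A' ** A = mat 1" B] assms unfolding matrix_inv_def by blast
  then have "B ** (A ** matrix_inv A) = B" by simp
  then show ?thesis by (simp add: matrix_mul_assoc assms)
qed

definition int_matrix :: "real^'n^'n \<Rightarrow> bool" where
  "int_matrix A \<longleftrightarrow> (\<forall>i j. A $ i $ j \<in> \<int>)"

lemma int_matrix_mult: "int_matrix A \<Longrightarrow> int_matrix B \<Longrightarrow> int_matrix (A ** B)"
  by (auto simp: int_matrix_def matrix_matrix_mult_def intro!: Ints_sum Ints_mult)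

lemma int_matrix_minus: "int_matrix A \<Longrightarrow> int_matrix (- A)"
  by (simp add: int_matrix_def)

lemma ract_mat_1: "ract x (mat 1) = x"
  by (simp add: ract_def)

lemma ract_mult: "ract x (g ** h) = ract (ract x g) h"
  by (simp add: ract_def vector_matrix_mul_assoc)

lemma ract_minus: "ract x (- g) = - ract x g"
  by (simp add: ract_def vector_matrix_mult_def vec_eq_iff sum_negf)

lemma row_mult: "(M ** N) $ i = ract (M $ i) N"
  by (simp add: ract_def vector_matrix_mult_def matrix_matrix_mult_def vec_eq_iff mult.commute)

lemma linear_ract: "linear (\<lambda>x. ract x (g::real^'n^'n))"
  unfolding ract_def transpose_matrix_vector[symmetric] by (rule matrix_vector_mul_linear)

lemma continuous_on_ract: "continuous_on S (\<lambda>x. ract x (g::real^'n^'n))"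
  by (rule linear_continuous_on[OF linear_ract[THEN linear_conv_bounded_linear[THEN iffD1]]])

lemma span_lattice: "span (lattice :: (real^'n) set) = UNIV"
proof -
  have "Basis \<subseteq> (lattice :: (real^'n) set)" by (auto simp: Basis_vec_def axis_lattice)
  then show ?thesis using span_mono[of Basis lattice] by auto
qed

context hyperbolic_cone
begin

text \<open>The bound is imposed on the dual lattice, because the distance from a basis vector to
  the span of the others is the inverse norm of a dual vector. It covers L as well, which lies in
  the dual lattice.\<close>

definition well_rounded :: "real \<Rightarrow> real^'n \<Rightarrow> bool" where
  "well_rounded \<mu> x \<longleftrightarrow> ip x x = 1 \<and> (\<forall>v\<in>dual_lattice Q. v \<noteq> 0 \<longrightarrow> \<mu> \<le> majorant x v v)"

definition unimodular :: "real^'n^'n \<Rightarrow> bool" where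
  "unimodular M \<longleftrightarrow> int_matrix M \<and> (\<exists>M'. int_matrix M' \<and> M' ** M = mat 1)"

lemma lattice_basis:
  assumes wr: "well_rounded \<mu> x" and \<mu>: "\<mu> > 0"
  obtains M where "unimodular M" "\<And>i. mnorm x (M $ i) \<le> 12 ^ DIM(real^'n) / sqrt \<mu>"
proof -
  have x: "ip x x = 1" and lb: "\<And>v. v \<in> dual_lattice Q \<Longrightarrow> v \<noteq> 0 \<Longrightarrow> sqrt \<mu> \<le> mnorm x v"
    using wr by (auto simp: well_rounded_def mnorm_def)
  interpret seminormed_group lattice "mnorm x"
    by unfold_locales (auto simp: lattice_def mnorm_triangle[OF x] mnorm_scale)
  \<comment> \<open>Halved because the reduction asks for a strict lower bound.\<close>
  have "sqrt \<mu> / 2 < mnorm x v" if "v \<in> lattice" "v \<noteq> 0" for v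
    using lb[of v] lattice_subset_dual that \<mu> real_sqrt_gt_zero[OF \<mu>] by (smt (verit) field_sum_of_halves subsetD)
  from reduced_basis[OF span_lattice _ this] \<mu> obtain X b r where
    X: "finite X" "card X = DIM(real^'n)" "X \<subseteq> lattice" "independent X" "lattice \<subseteq> int_span X"
    and b: "b \<in> X" "r > 0" "\<And>y. y \<in> X \<Longrightarrow> mnorm x y \<le> 12 ^ DIM(real^'n) * r"
      "\<And>s. s \<in> span (X - {b}) \<Longrightarrow> 4 * r < mnorm x (b - s)"
    by (metis half_gt_zero real_sqrt_gt_zero)
  have spanX: "span X = UNIV"
    using card_ge_dim_independent[of X UNIV] X by auto
  \<comment> \<open>v will be the member of the dual basis of X that belongs to b. Lattice vectors
    have integral coefficients in X, which puts v into the dual lattice.\<close>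
  have "linear (\<lambda>y. representation X y b)"
    using X(4) spanX by (intro linearI) (simp_all add: representation_add representation_scale)
  then obtain v where v: "\<And>y. representation X y b = ip y v"
    by (rule represent_functional) (rule that)
  have vdual: "v \<in> dual_lattice Q"
    unfolding dual_lattice_def
  proof safe
    fix y :: "real^'n" assume "y \<in> lattice"
    then obtain k :: "real^'n \<Rightarrow> int" where y: "y = (\<Sum>c\<in>X. of_int (k c) *\<^sub>R c)"
      using X(5) by (auto simp: int_span_def)
    have "representation X y b = (\<Sum>c\<in>X. representation X (of_int (k c) *\<^sub>R c) b)"
      unfolding y using X(4) by (subst representation_sum) (auto simp: spanX)
    also have "\<dots> = (\<Sum>c\<in>X. of_int (k c) * (if b = c then 1 else 0))"
      using X(4) by (intro sum.cong refl) (subst representation_scale, auto simp: spanX representation_basis)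
    also have "\<dots> = of_int (k b)" using X(1) b(1) by (simp add: if_distrib sum.delta cong: if_cong)
    finally show "ip v y \<in> \<int>" using v[of y] ip_commute[of v y] by simp
  qed
  have bv: "ip b v = 1" using v[of b] representation_basis[OF X(4) b(1)] by simp
  then have v0: "v \<noteq> 0" by (auto simp: bform_simps)
  define m where "m = majorant x v v"
  have m: "m > 0" using majorant_pos[OF x v0] by (simp add: m_def)
  \<comment> \<open>\<open>w\<close> realises the distance from b to the hyperplane spanned by the other basis vectors.\<close>
  define w where "w = (1 / m) *\<^sub>R flip x v"
  have "ip w v = 1"
    using m majorant_flip[of x v v] ip_commute[of v "flip x v"] by (simp add: w_def bform_simps m_def)
  then have "representation X (b - w) b = 0" using v bv by (simp add: bform_simps)
  then have "b - w = (\<Sum>c\<in>X - {b}. representation X (b - w) c *\<^sub>R c)"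
    using real_vector.sum_representation_eq[OF X(4), of "b - w" X] X(1) spanX b(1)
    by (simp add: sum.remove)
  also have "\<dots> \<in> span (X - {b})" by (intro span_sum span_scale span_base)
  finally have "4 * r < mnorm x (b - (b - w))" by (rule b(4))
  also have "\<dots> = mnorm x v / m" using m by (simp add: w_def mnorm_scale mnorm_flip[OF x])
  also have "\<dots> = 1 / mnorm x v"
    using mnorm_sq[OF x, of v] mnorm_pos[OF x v0] m
    unfolding m_def[symmetric] by (simp add: field_simps power2_eq_square)
  also have "\<dots> \<le> 1 / sqrt \<mu>" using lb[OF vdual v0] \<mu> mnorm_pos[OF x v0] by (intro divide_left_mono) auto
  finally have r: "r \<le> 1 / sqrt \<mu>" using b(2) by simp
  obtain f where f: "bij_betw f (UNIV::'n set) X"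
    using finite_same_card_bij[of "UNIV::'n set" X] X by auto
  define M :: "real^'n^'n" where "M = (\<chi> i. f i)"
  have fX: "f i \<in> X" for i using f by (auto simp: bij_betw_def)
  \<comment> \<open>The rows of \<open>M'\<close> are the coordinates of the standard basis vectors
    with respect to X, which makes it an integral inverse of M.\<close>
  have "\<exists>k :: real^'n \<Rightarrow> int. axis i 1 = (\<Sum>c\<in>X. of_int (k c) *\<^sub>R c)" for i :: 'n
    using X(5) axis_lattice[of i] by (auto simp: int_span_def)
  then obtain k :: "'n \<Rightarrow> real^'n \<Rightarrow> int" where k: "\<And>i. axis i 1 = (\<Sum>c\<in>X. of_int (k i c) *\<^sub>R c)" by metis
  define M' :: "real^'n^'n" where "M' = (\<chi> i j. of_int (k i (f j)))"
  have "M' ** M = mat 1"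
  proof -
    have "axis i 1 = (\<Sum>j\<in>UNIV. of_int (k i (f j)) *\<^sub>R f j)" for i
      unfolding k by (rule sum.reindex_bij_betw[OF f, symmetric])
    then have "(M' ** M) $ i $ j = axis i 1 $ j" for i j
      by (simp add: matrix_matrix_mult_def M'_def M_def)
    then show ?thesis by (simp add: vec_eq_iff mat_def axis_def)
  qed
  moreover have "int_matrix M" using fX X(3) by (auto simp: int_matrix_def M_def lattice_def)
  moreover have "int_matrix M'" by (simp add: int_matrix_def M'_def)
  moreover have "mnorm x (M $ i) \<le> 12 ^ DIM(real^'n) / sqrt \<mu>" for i
  proof -
    have "mnorm x (M $ i) \<le> 12 ^ DIM(real^'n) * r" using b(3)[OF fX] by (simp add: M_def)
    also have "\<dots> \<le> 12 ^ DIM(real^'n) * (1 / sqrt \<mu>)" by (rule mult_left_mono[OF r]) simp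
    finally show ?thesis by simp
  qed
  ultimately show thesis using that by (auto simp: unimodular_def)
qed

text \<open>An isometry maps P to itself or to its negative, so a single point of P with image in P
  decides.\<close>

lemma orth_plusI:
  assumes g: "int_matrix g" "int_matrix g'" "g' ** g = mat 1"
    and iso: "g ** Q ** transpose g = Q" and x: "x \<in> P" "ract x g \<in> P"
  shows "g \<in> orth_plus Q P"
proof -
  have isom: "ip (ract y g) (ract z g) = ip y z" for y z by (simp add: bform_ract iso)
  have gg': "g ** g' = mat 1" using g(3) by (simp add: matrix_left_right_inverse)
  have "(\<lambda>x. ract x g) ` P = P"
  proof safe
    fix y assume "y \<in> P"
    then show "ract y g \<in> P" using x by (intro P_I[OF x(2)]) (simp_all add: isom P_pos P_mult_pos)
  next
    fix y assume y: "y \<in> P"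
    have eq: "y = ract (ract y g') g" by (simp add: g(3) ract_mat_1 flip: ract_mult)
    have "ract y g' \<in> P"
    proof (rule P_I[OF x(1)])
      show "ip (ract y g') (ract y g') > 0" using P_pos[OF y] isom[of "ract y g'" "ract y g'"] eq by simp
      show "ip x (ract y g') > 0" using P_mult_pos[OF x(2) y] isom[of x "ract y g'"] eq by simp
    qed
    then show "y \<in> (\<lambda>x. ract x g) ` P" using eq by blast
  qed
  moreover have "invertible g" using g(3) gg' by (auto simp: invertible_def)
  moreover have "matrix_inv g = g'" by (rule matrix_inv_eqI) fact
  ultimately show ?thesis
    using g isom by (auto simp: orth_plus_def int_matrix_def)
qed

section \<open>Gram matrices of lattice bases and the compact set\<close>

definition gram :: "real^'n^'n \<Rightarrow> real^'n^'n" where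
  "gram M = M ** Q ** transpose M"

lemma gram_nth: "gram M $ i $ j = ip (M $ i) (M $ j)"
proof -
  have "gram M $ i $ j = (M ** Q) $ i \<bullet> M $ j"
    by (simp add: gram_def matrix_matrix_mult_def[of "M ** Q"] transpose_def inner_vec_def)
  also have "\<dots> = ip (M $ i) (M $ j)"
    by (simp add: row_mult ract_def dot_lmul_matrix bform_def)
  finally show ?thesis .
qed

text \<open>\<open>M' ** N\<close> is the base change that sends the rows of M to those of N; equal
  products of the two bases make it an isometry.\<close>

lemma gram_transport:
  assumes "M' ** M = mat 1" "gram N = gram M"
  shows "(M' ** N) ** Q ** transpose (M' ** N) = Q"
proof -
  have "(M' ** N) ** Q ** transpose (M' ** N) = M' ** gram N ** transpose M'"
    by (simp add: gram_def matrix_transpose_mul matrix_mul_assoc)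
  also have "\<dots> = (M' ** M) ** Q ** transpose (M' ** M)"
    unfolding assms(2) by (simp add: gram_def matrix_transpose_mul matrix_mul_assoc)
  finally show ?thesis by (simp add: assms(1) transpose_mat)
qed

definition bounded_on_rows :: "real \<Rightarrow> real^'n^'n \<Rightarrow> (real^'n) set" where
  "bounded_on_rows \<kappa> M = {y\<in>P. ip y y = 1 \<and> (\<forall>i. \<bar>ip y (M $ i)\<bar> \<le> \<kappa>)}"

text \<open>Closed although P is open: among vectors of square 1, membership in P amounts to ip x y
  \<ge> 0 for a fixed x in P, since positive vectors are never orthogonal. Bounded because the
  products with the rows of an invertible M are linear coordinates.\<close>

lemma compact_bounded_on_rows:
  assumes M: "M' ** M = mat 1"
  shows "compact (bounded_on_rows \<kappa> M)"
proof -
  obtain x where x: "x \<in> P" using P_nonempty by blast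
  have "bounded_on_rows \<kappa> M = {y. ip x y \<ge> 0} \<inter> {y. ip y y = 1} \<inter> (\<Inter>i. {y. \<bar>ip y (M $ i)\<bar> \<le> \<kappa>})"
    (is "_ = ?R")
  proof safe
    fix y assume y: "ip x y \<ge> 0" "ip y y = 1" "y \<in> (\<Inter>i. {y. \<bar>ip y (M $ i)\<bar> \<le> \<kappa>})"
    have "ip x y \<noteq> 0" using positive_not_orthogonal[of x y] P_pos[OF x] y by simp
    then have "y \<in> P" using y by (intro P_I[OF x]) auto
    then show "y \<in> bounded_on_rows \<kappa> M" using y by (auto simp: bounded_on_rows_def)
  qed (use P_mult_pos[OF x] in \<open>auto simp: bounded_on_rows_def less_imp_le\<close>)
  moreover have "closed ?R"
    by (intro closed_Int closed_INT ballI closed_Collect_le closed_Collect_eq continuous_intros)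
  moreover have "bounded (bounded_on_rows \<kappa> M)"
  proof -
    define f where "f y = M *v (Q *v y)" for y
    have fi: "f y $ i = ip y (M $ i)" for y i
      using ip_commute[of y "M $ i"] by (simp add: f_def bform_def matrix_vector_mul_component)
    have lin: "linear f" unfolding f_def matrix_vector_mul_assoc by (rule matrix_vector_mul_linear)
    have "inj f"
    proof (rule linear_injective_0[THEN iffD2, OF lin], safe)
      fix y assume "f y = 0"
      then have "M' *v (M *v (Q *v y)) = 0" by (simp add: f_def)
      then have "Q *v y = 0" by (simp add: matrix_vector_mul_assoc matrix_mul_assoc M)
      then show "y = 0" by (intro nondegenerate, subst ip_commute) (simp add: bform_def)
    qed
    with lin obtain B where B: "B > 0" "\<And>y. B * norm y \<le> norm (f y)"
      by (rule linear_inj_bounded_below_pos) blast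
    have "norm y \<le> (\<Sum>i\<in>(UNIV::'n set). \<kappa>) / B" if "y \<in> bounded_on_rows \<kappa> M" for y
    proof -
      have "norm (f y) \<le> (\<Sum>i\<in>UNIV. \<bar>f y $ i\<bar>)" by (rule norm_le_l1_cart)
      also have "\<dots> \<le> (\<Sum>i\<in>(UNIV::'n set). \<kappa>)"
        using that by (intro sum_mono) (auto simp: fi bounded_on_rows_def)
      finally show ?thesis using B(1) order_trans[OF B(2)] by (simp add: field_simps)
    qed
    then show ?thesis by (auto simp: bounded_iff)
  qed
  ultimately show ?thesis by (simp add: compact_eq_bounded_closed)
qed

proposition well_rounded_compact:
  assumes \<mu>: "\<mu> > 0"
  obtains K where "compact K" "K \<subseteq> P"
    "\<And>x. x \<in> P \<Longrightarrow> well_rounded \<mu> x \<Longrightarrow> \<exists>g\<in>orth_plus Q P. ract x g \<in> K"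
proof -
  define \<kappa> where "\<kappa> = 12 ^ DIM(real^'n) / sqrt \<mu>"
  define red where "red M x \<longleftrightarrow> ip x x = 1 \<and> unimodular M \<and> (\<forall>i. mnorm x (M $ i) \<le> \<kappa>)" for M x
  define S where "S = {gram M | M x. red M x}"
  have rows: "M $ i \<in> lattice" if "unimodular M" for M i
    using that by (auto simp: unimodular_def int_matrix_def lattice_def)
  have "finite S"
  proof -
    have "ip (M $ i) (M $ j) \<in> \<int> \<and> \<bar>ip (M $ i) (M $ j)\<bar> \<le> \<kappa> * \<kappa>" if "red M x" for M x i j
    proof
      show "ip (M $ i) (M $ j) \<in> \<int>"
        using rows[of M] that L by (simp add: red_def even_hyperbolic_lattice_def)
      have x: "ip x x = 1" and le: "mnorm x (M $ i) \<le> \<kappa>" "mnorm x (M $ j) \<le> \<kappa>"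
        using that by (auto simp: red_def)
      show "\<bar>ip (M $ i) (M $ j)\<bar> \<le> \<kappa> * \<kappa>"
        using ip_bound[OF x, of "M $ i" "M $ j"] mult_mono[OF le] mnorm_nonneg[OF x] le
        by (meson order_trans)
    qed
    then have "S \<subseteq> {A. \<forall>i. A $ i \<in> {x. \<forall>j. x $ j \<in> {t. t \<in> \<int> \<and> \<bar>t\<bar> \<le> \<kappa> * \<kappa>}}}"
      by (auto simp: S_def gram_nth)
    then show ?thesis
      by (rule finite_subset) (intro finite_vecs_in finite_abs_int_segment)
  qed
  \<comment> \<open>One basis is fixed for each of the finitely many Gram matrices; all points
    sharing that matrix will be moved to it.\<close>
  define rep where "rep \<Gamma> = (SOME M. unimodular M \<and> gram M = \<Gamma>)" for \<Gamma>
  have rep: "unimodular (rep \<Gamma>)" "gram (rep \<Gamma>) = \<Gamma>" if "\<Gamma> \<in> S" for \<Gamma>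
    using someI_ex[of "\<lambda>M. unimodular M \<and> gram M = \<Gamma>"] that unfolding rep_def S_def red_def by auto
  define K where "K = (\<Union>\<Gamma>\<in>S. bounded_on_rows \<kappa> (rep \<Gamma>))"
  show thesis
  proof
    show "compact K"
      unfolding K_def using rep(1) \<open>finite S\<close> compact_bounded_on_rows
      by (intro compact_UN) (auto simp: unimodular_def)
    show "K \<subseteq> P" by (auto simp: K_def bounded_on_rows_def)
    fix x assume x: "x \<in> P" "well_rounded \<mu> x"
    obtain M where M: "red M x"
      using lattice_basis[OF x(2) \<mu>] x(2) unfolding red_def well_rounded_def \<kappa>_def by metis
    then obtain M' where M': "int_matrix M" "int_matrix M'" "M' ** M = mat 1"
      by (auto simp: red_def unimodular_def)
    have \<Gamma>: "gram M \<in> S" using M by (auto simp: S_def)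
    define N where "N = rep (gram M)"
    have N: "unimodular N" "gram N = gram M" using rep[OF \<Gamma>] by (auto simp: N_def)
    then obtain N' where N': "int_matrix N" "int_matrix N'" "N' ** N = mat 1"
      by (auto simp: unimodular_def)
    \<comment> \<open>g carries the basis M, short at x, to the representative N. Hence the image of
      x has the same products with the rows of N as x has with those of M.\<close>
    define g where "g = M' ** N"
    have MM': "M ** M' = mat 1" using M'(3) by (simp add: matrix_left_right_inverse)
    have iso: "g ** Q ** transpose g = Q" unfolding g_def by (rule gram_transport) (use M' N in auto)
    have gi: "int_matrix g" "int_matrix (N' ** M)" using M' N' by (auto simp: g_def int_matrix_mult)
    have "(N' ** M) ** g = N' ** (M ** M') ** N" by (simp add: g_def matrix_mul_assoc)
    then have gg: "(N' ** M) ** g = mat 1" by (simp add: MM' N')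
    have isom: "ip (ract y g) (ract z g) = ip y z" for y z by (simp add: bform_ract iso)
    have row: "N $ i = ract (M $ i) g" for i
      unfolding g_def row_mult[symmetric] matrix_mul_assoc MM' by simp
    have bd: "\<bar>ip (ract x g) (N $ i)\<bar> \<le> \<kappa>" for i
    proof -
      have x1: "ip x x = 1" using M by (simp add: red_def)
      have "(ip x (M $ i))\<^sup>2 \<le> (mnorm x (M $ i))\<^sup>2" using majorant_ge(1)[OF x1] by (simp add: mnorm_sq[OF x1])
      then have "(\<bar>ip x (M $ i)\<bar>)\<^sup>2 \<le> (mnorm x (M $ i))\<^sup>2" by simp
      then have "\<bar>ip x (M $ i)\<bar> \<le> mnorm x (M $ i)"
        by (rule power2_le_imp_le) (rule mnorm_nonneg[OF x1])
      also have "\<dots> \<le> \<kappa>" using M by (simp add: red_def)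
      finally show ?thesis by (simp add: row isom)
    qed
    have one: "ip (ract x g) (ract x g) = 1" using x by (simp add: isom well_rounded_def)
    show "\<exists>g\<in>orth_plus Q P. ract x g \<in> K"
    proof (cases "ract x g \<in> P")
      case True
      then have "ract x g \<in> K" using \<Gamma> one bd by (auto simp: K_def bounded_on_rows_def N_def)
      moreover have "g \<in> orth_plus Q P" by (rule orth_plusI[OF gi gg iso x(1) True])
      ultimately show ?thesis by blast
    next
      case False
      \<comment> \<open>g may move x to the opposite cone. The Gram matrix and the bounds on
        absolute values do not see signs, so -g works instead.\<close>
      have neg: "ract x (- g) \<in> P"
      proof -
        have "ip x (ract x g) \<noteq> 0" using positive_not_orthogonal[OF P_pos[OF x(1)], of "ract x g"] one by simp
        moreover have "\<not> ip x (ract x g) > 0" using False one P_I[OF x(1)] by auto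
        ultimately show ?thesis using one by (intro P_I[OF x(1)]) (auto simp: ract_minus bform_simps)
      qed
      then have "ract x (- g) \<in> K" using \<Gamma> one bd by (auto simp: K_def bounded_on_rows_def N_def ract_minus bform_simps)
      moreover have "- g \<in> orth_plus Q P"
      proof (rule orth_plusI[OF _ _ _ _ x(1) neg])
        show "int_matrix (- g)" "int_matrix (- (N' ** M))" using gi by (auto intro: int_matrix_minus)
        show "- (N' ** M) ** - g = mat 1" using gg by (simp add: matrix_matrix_mult_def vec_eq_iff)
        have "- g ** Q ** transpose (- g) = g ** Q ** transpose g"
          by (simp add: matrix_matrix_mult_def transpose_def vec_eq_iff sum_negf)
        then show "- g ** Q ** transpose (- g) = Q" using iso by simp
      qed
      ultimately show ?thesis by blast
    qed
  qed
qed

end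

section \<open>Local finiteness of the walls\<close>

lemma countable_lattice: "countable (lattice :: (real^'n) set)"
proof -
  have "(lattice :: (real^'n) set) \<subseteq> (\<Union>n. lattice \<inter> cball 0 (real n))"
  proof
    fix x :: "real^'n" assume x: "x \<in> lattice"
    obtain n where n: "norm x \<le> real n" using real_arch_simple by blast
    show "x \<in> (\<Union>n. lattice \<inter> cball 0 (real n))"
      using x n by (intro UN_I[of n]) auto
  qed
  moreover have "countable (\<Union>n. lattice \<inter> cball (0::real^'n) (real n))"
    by (rule countable_UN) (auto intro: countable_finite finite_lattice_cball)
  ultimately show ?thesis by (rule countable_subset)
qed

locale chamber_family = hyperbolic_cone Q P for Q :: "real^'n^'n" and P +
  fixes V :: "(real^'n) set" and c :: real
  assumes V: "V \<subseteq> neg_vectors Q \<inter> dual_lattice Q"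
    and c_pos: "c > 0"
    and V_bound: "v \<in> V \<Longrightarrow> - ip v v < c"
begin

definition regular :: "(real^'n) set" where
  "regular = P - (\<Union>v\<in>V. perp Q P v)"

lemma regular_iff: "y \<in> regular \<longleftrightarrow> y \<in> P \<and> (\<forall>v\<in>V. ip y v \<noteq> 0)"
  by (auto simp: regular_def perp_def)

definition walls :: "real^'n \<Rightarrow> (real^'n) set" where
  "walls z = {v \<in> V. ip z v = 0}"

definition isolating :: "real^'n \<Rightarrow> real \<Rightarrow> bool" where
  "isolating z \<delta> \<longleftrightarrow> \<delta> > 0 \<and> ball z \<delta> \<subseteq> P \<and> finite (walls z) \<and>
     (\<forall>v\<in>V. \<forall>y\<in>ball z \<delta>. ip y v = 0 \<longrightarrow> v \<in> walls z)"

text \<open>Below \<open>gap\<close>, integrality of \<open>disc * ip v w\<close> on the dual lattice forces both \<open>ip v v\<close> and the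
  products of \<open>v\<close> with walls to vanish.\<close>

definition gap :: real where
  "gap = min (1 / (2 * disc)) (1 / (2 * c * disc\<^sup>2))"

lemma gap: "gap > 0" "gap < 1 / disc" "gap * c < (1 / disc)\<^sup>2"
proof -
  show "gap > 0" using disc_pos c_pos by (simp add: gap_def)
  have "gap \<le> 1 / (2 * disc)" by (simp add: gap_def)
  also have "\<dots> < 1 / disc" using disc_pos by (simp add: field_simps)
  finally show "gap < 1 / disc" .
  have "gap * c \<le> 1 / (2 * c * disc\<^sup>2) * c" using c_pos by (intro mult_right_mono) (simp_all add: gap_def)
  also have "\<dots> < (1 / disc)\<^sup>2" using disc_pos c_pos by (simp add: field_simps power2_eq_square)
  finally show "gap * c < (1 / disc)\<^sup>2" .
qed

lemma majorant_coercive: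
  assumes x: "ip x x = 1"
  obtains \<kappa> where "\<kappa> > 0" "\<And>v. \<kappa> * (norm v)\<^sup>2 \<le> majorant x v v"
proof -
  have "\<exists>u\<in>sphere 0 1. \<forall>v\<in>sphere (0::real^'n) 1. majorant x u u \<le> majorant x v v"
    unfolding majorant_def by (intro continuous_attains_inf continuous_intros compact_sphere) auto
  then obtain u where u: "norm u = 1" "\<And>v. norm v = 1 \<Longrightarrow> majorant x u u \<le> majorant x v v" by auto
  have "majorant x u u * (norm v)\<^sup>2 \<le> majorant x v v" for v
  proof (cases "v = 0")
    case False
    let ?w = "(1 / norm v) *\<^sub>R v"
    have "majorant x u u \<le> majorant x ?w ?w" using False by (intro u) simp
    also have "\<dots> = majorant x v v / (norm v)\<^sup>2" by (simp add: majorant_simps power2_eq_square)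
    finally show ?thesis using False by (simp add: field_simps)
  qed (simp add: majorant_def bform_simps)
  moreover have "majorant x u u > 0" using u by (intro majorant_pos x) auto
  ultimately show thesis using that by blast
qed

lemma ip_norm_bound:
  obtains B where "B > 0" "\<And>x y. \<bar>ip x y\<bar> \<le> B * norm x * norm y"
proof -
  obtain B where B: "B > 0" "\<And>y. norm (Q *v y) \<le> B * norm y"
    using linear_bounded_pos[OF matrix_vector_mul_linear, of Q] by metis
  have "\<bar>ip x y\<bar> \<le> B * norm x * norm y" for x y
  proof -
    have "\<bar>ip x y\<bar> \<le> norm x * norm (Q *v y)" unfolding bform_def by (rule Cauchy_Schwarz_ineq2)
    also have "\<dots> \<le> norm x * (B * norm y)" by (intro mult_left_mono B) auto
    finally show ?thesis by (simp add: mult_ac)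
  qed
  with B(1) show thesis by (rule that)
qed

text \<open>If v is orthogonal to a point near z, then ip z v is small compared with norm v. The
  majorant of v at the normalised z is then below c plus half of its own lower bound \<kappa> times
  the squared norm; this bounds v, and a ball contains only finitely many dual vectors.\<close>

lemma locally_finite:
  assumes z: "z \<in> P"
  obtains \<delta> where "\<delta> > 0" "finite {v\<in>V. \<exists>y\<in>ball z \<delta>. ip y v = 0}"
proof -
  define s where "s = 1 / sqrt (ip z z)"
  have s: "s > 0" using P_pos[OF z] by (simp add: s_def)
  have x: "ip (s *\<^sub>R z) (s *\<^sub>R z) = 1" using normalize(2)[OF z] by (simp add: s_def)
  obtain \<kappa> where \<kappa>: "\<kappa> > 0" "\<And>v. \<kappa> * (norm v)\<^sup>2 \<le> majorant (s *\<^sub>R z) v v"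
    using majorant_coercive[OF x] by blast
  obtain B where B: "B > 0" "\<And>x y. \<bar>ip x y\<bar> \<le> B * norm x * norm y"
    using ip_norm_bound by blast
  \<comment> \<open>Chosen so that s * B * \<delta> = sqrt \<kappa> / 2; twice the square of this
    uses up half of \<kappa>.\<close>
  define \<delta> where "\<delta> = sqrt \<kappa> / (2 * s * B)"
  have \<delta>: "\<delta> > 0" using s \<kappa> B by (simp add: \<delta>_def)
  have "norm v \<le> sqrt (2 * c / \<kappa>)" if v: "v \<in> V" and y: "y \<in> ball z \<delta>" "ip y v = 0" for v y
  proof -
    have "\<bar>ip (s *\<^sub>R z) v\<bar> = s * \<bar>ip (z - y) v\<bar>" using y s by (simp add: bform_simps abs_mult)
    also have "\<dots> \<le> s * (B * norm (z - y) * norm v)" using s by (intro mult_left_mono B) auto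
    also have "\<dots> \<le> s * (B * \<delta> * norm v)"
      using s B(1) y by (intro mult_left_mono mult_right_mono) (auto simp: dist_norm)
    also have "\<dots> = sqrt \<kappa> / 2 * norm v" using s B(1) by (simp add: \<delta>_def)
    finally have "\<bar>ip (s *\<^sub>R z) v\<bar>\<^sup>2 \<le> (sqrt \<kappa> / 2 * norm v)\<^sup>2" by (rule power_mono) simp
    then have "(ip (s *\<^sub>R z) v)\<^sup>2 \<le> \<kappa> / 4 * (norm v)\<^sup>2" using \<kappa>(1) by (simp add: power_mult_distrib power_divide)
    moreover have "majorant (s *\<^sub>R z) v v < 2 * (ip (s *\<^sub>R z) v)\<^sup>2 + c"
      using V_bound[OF v] by (simp add: majorant_def power2_eq_square)
    ultimately have "\<kappa> * (norm v)\<^sup>2 \<le> 2 * c" using \<kappa>(2)[of v] by simp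
    then have "(norm v)\<^sup>2 \<le> 2 * c / \<kappa>" using \<kappa>(1) by (simp add: field_simps)
    then show ?thesis by (rule real_le_rsqrt)
  qed
  then have "{v\<in>V. \<exists>y\<in>ball z \<delta>. ip y v = 0} \<subseteq> dual_lattice Q \<inter> cball 0 (sqrt (2 * c / \<kappa>))"
    using V by auto
  then have "finite {v\<in>V. \<exists>y\<in>ball z \<delta>. ip y v = 0}" using finite_dual_cball finite_subset by blast
  with \<delta> show thesis by (rule that)
qed

lemma isolating_exists:
  assumes z: "z \<in> P"
  obtains \<delta> where "isolating z \<delta>"
proof -
  obtain \<delta>0 where \<delta>0: "\<delta>0 > 0" "finite {v\<in>V. \<exists>y\<in>ball z \<delta>0. ip y v = 0}" (is "finite ?F")
    using locally_finite[OF z] by blast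
  define U where "U = P \<inter> ball z \<delta>0 \<inter> (\<Inter>v\<in>?F - walls z. {y. ip y v \<noteq> 0})"
  have "open U"
    unfolding U_def using \<delta>0(2)
    by (intro open_Int open_P open_ball open_INT ballI open_Collect_neq continuous_intros) auto
  moreover have "z \<in> U" using z \<delta>0 by (auto simp: U_def walls_def)
  ultimately obtain \<delta> where \<delta>: "\<delta> > 0" "ball z \<delta> \<subseteq> U" by (meson openE)
  have "walls z \<subseteq> ?F" using \<delta>0(1) by (auto simp: walls_def intro!: bexI[of _ z])
  then have "finite (walls z)" using \<delta>0(2) finite_subset by blast
  moreover have "v \<in> walls z" if "v \<in> V" "y \<in> ball z \<delta>" "ip y v = 0" for v y
  proof (rule ccontr)
    assume "v \<notin> walls z"
    moreover have "y \<in> U" using \<delta> that by blast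
    moreover have "y \<in> ball z \<delta>0" using \<open>y \<in> U\<close> by (simp add: U_def)
    ultimately have "v \<in> ?F - walls z" using that by blast
    with \<open>y \<in> U\<close> that(3) show False unfolding U_def by blast
  qed
  ultimately have "isolating z \<delta>" using \<delta> by (auto simp: isolating_def U_def)
  then show thesis by (rule that)
qed

text \<open>The points of the ball on the same side as y of every wall through z form a convex set,
  and no other member of V has a zero in the ball.\<close>

lemma same_component:
  assumes \<delta>: "isolating z \<delta>" and y: "y \<in> ball z \<delta>" "y' \<in> ball z \<delta>" "y \<in> regular"
    and sign: "\<And>v. v \<in> walls z \<Longrightarrow> ip y v * ip y' v > 0"
  shows "connected_component regular y y'"
proof -
  define T where "T = ball z \<delta> \<inter> (\<Inter>v\<in>walls z. {u. ip y v * ip u v > 0})"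
  have "{u. ip y v * ip u v > 0} = {u. (ip y v *\<^sub>R (Q *v v)) \<bullet> u > 0}" for v
    by (simp add: bform_def[of Q _ v] inner_commute)
  then have "convex {u. ip y v * ip u v > 0}" for v
    by (metis convex_halfspace_gt)
  then have "convex T" unfolding T_def
    by (intro convex_Int convex_INT convex_ball)
  moreover have "T \<subseteq> regular"
    using \<delta> by (force simp: T_def regular_iff isolating_def)
  moreover have "y \<in> T" "y' \<in> T"
    using y sign \<delta> by (auto simp: T_def regular_iff walls_def zero_less_mult_iff not_less_iff_gr_or_eq)
  ultimately show ?thesis by (intro connected_componentI convex_connected)
qed

section \<open>Finitely many chambers near a point and on a compact set\<close>

lemma chamber_iff:
  "chamber Q P V D \<longleftrightarrow> (\<exists>y\<in>regular. D = P \<inter> closure (connected_component_set regular y))"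
  unfolding chamber_def regular_def[symmetric] by (auto simp: components_def)

text \<open>A chamber meeting the open ball has a point of its component there, and the signs of
  that point on the finitely many walls through z determine the component.\<close>

lemma finite_chambers_near:
  assumes \<delta>: "isolating z \<delta>"
  shows "finite {D. chamber Q P V D \<and> D \<inter> ball z \<delta> \<noteq> {}}"
proof -
  define sg where "sg y = {v \<in> walls z. ip y v > 0}" for y
  \<comment> \<open>Arbitrary for sign patterns that no regular point of the ball realises, which is
    harmless since only an inclusion is needed.\<close>
  define rep where "rep S = (SOME y. y \<in> regular \<inter> ball z \<delta> \<and> sg y = S)" for S
  have "{D. chamber Q P V D \<and> D \<inter> ball z \<delta> \<noteq> {}} \<subseteq>
    (\<lambda>S. P \<inter> closure (connected_component_set regular (rep S))) ` Pow (walls z)"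
  proof
    fix D assume "D \<in> {D. chamber Q P V D \<and> D \<inter> ball z \<delta> \<noteq> {}}"
    then obtain u where D: "chamber Q P V D" and u: "u \<in> D" "u \<in> ball z \<delta>" by blast
    obtain y0 where y0: "D = P \<inter> closure (connected_component_set regular y0)"
      using D by (auto simp: chamber_iff)
    with u have "ball z \<delta> \<inter> closure (connected_component_set regular y0) \<noteq> {}" by blast
    then obtain y where y: "y \<in> ball z \<delta>" "connected_component regular y0 y"
      by (auto simp: open_Int_closure_eq_empty)
    then have yr: "y \<in> regular" by (meson connected_component_in)
    have r: "rep (sg y) \<in> regular \<inter> ball z \<delta> \<and> sg (rep (sg y)) = sg y"
      unfolding rep_def by (rule someI[of _ y]) (use y yr in auto)
    have "ip y v * ip (rep (sg y)) v > 0" if v: "v \<in> walls z" for v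
    proof -
      have "ip y v \<noteq> 0" "ip (rep (sg y)) v \<noteq> 0" using yr r v by (auto simp: regular_iff walls_def)
      moreover have "ip y v > 0 \<longleftrightarrow> ip (rep (sg y)) v > 0" using r v by (auto simp: sg_def)
      ultimately show ?thesis by (auto simp: zero_less_mult_iff)
    qed
    then have "connected_component regular y (rep (sg y))"
      using y yr r by (intro same_component[OF \<delta>]) auto
    with y(2) have "connected_component regular y0 (rep (sg y))" by (rule connected_component_trans)
    then have "connected_component_set regular (rep (sg y)) = connected_component_set regular y0"
      by (intro connected_component_eq) simp
    moreover have "sg y \<in> Pow (walls z)" by (auto simp: sg_def)
    ultimately show "D \<in> (\<lambda>S. P \<inter> closure (connected_component_set regular (rep S))) ` Pow (walls z)"
      using y0 by (intro image_eqI[of _ _ "sg y"]) simp_all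
  qed
  moreover have "finite (Pow (walls z))" using \<delta> by (simp add: isolating_def)
  ultimately show ?thesis by (rule finite_subset[OF _ finite_imageI])
qed

lemma finite_chambers_compact:
  assumes K: "compact K" "K \<subseteq> P"
  shows "finite {D. chamber Q P V D \<and> D \<inter> K \<noteq> {}}"
proof -
  have "\<forall>z\<in>K. \<exists>\<delta>. isolating z \<delta>" using isolating_exists K(2) by blast
  from bchoice[OF this] obtain \<delta> where \<delta>: "\<And>z. z \<in> K \<Longrightarrow> isolating z (\<delta> z)" by blast
  then have "z \<in> ball z (\<delta> z)" if "z \<in> K" for z using that by (simp add: isolating_def)
  then have "K \<subseteq> (\<Union>z\<in>K. ball z (\<delta> z))" by blast
  then obtain F where F: "F \<subseteq> K" "finite F" "K \<subseteq> (\<Union>z\<in>F. ball z (\<delta> z))"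
    using compactE_image[OF K(1), of K "\<lambda>z. ball z (\<delta> z)"] by auto
  have "{D. chamber Q P V D \<and> D \<inter> K \<noteq> {}} \<subseteq> (\<Union>z\<in>F. {D. chamber Q P V D \<and> D \<inter> ball z (\<delta> z) \<noteq> {}})"
  proof
    fix D assume "D \<in> {D. chamber Q P V D \<and> D \<inter> K \<noteq> {}}"
    then obtain u where "chamber Q P V D" "u \<in> D" "u \<in> K" by blast
    moreover from this F(3) obtain z where "z \<in> F" "u \<in> ball z (\<delta> z)" by blast
    ultimately show "D \<in> (\<Union>z\<in>F. {D. chamber Q P V D \<and> D \<inter> ball z (\<delta> z) \<noteq> {}})" by blast
  qed
  moreover have "finite (\<Union>z\<in>F. {D. chamber Q P V D \<and> D \<inter> ball z (\<delta> z) \<noteq> {}})"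
    using F \<delta> by (intro finite_UN_I finite_chambers_near) auto
  ultimately show ?thesis by (rule finite_subset)
qed

lemma chamber_image:
  assumes g: "\<And>y z. ip (ract y g) (ract z g) = ip y z"
    and inv: "h ** g = mat 1"
    and P: "\<And>y. y \<in> P \<Longrightarrow> ract y g \<in> P" "\<And>y. y \<in> P \<Longrightarrow> ract y h \<in> P"
    and V: "\<And>v. v \<in> V \<Longrightarrow> ract v g \<in> V" "\<And>v. v \<in> V \<Longrightarrow> ract v h \<in> V"
    and D: "chamber Q P V D"
  shows "chamber Q P V ((\<lambda>x. ract x g) ` D)"
proof -
  have inv': "g ** h = mat 1" using inv by (simp add: matrix_left_right_inverse)
  have gh: "ract (ract y g) h = y" "ract (ract y h) g = y" for y
    by (simp_all add: inv inv' ract_mat_1 flip: ract_mult)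
  have h: "ip (ract y h) z = ip y (ract z g)" for y z using g[of "ract y h" z] by (simp add: gh)
  have h': "ip (ract y g) z = ip y (ract z h)" for y z using g[of y "ract z h"] by (simp add: gh)
  obtain y0 where y0: "y0 \<in> regular" "D = P \<inter> closure (connected_component_set regular y0)"
    using D by (auto simp: chamber_iff)
  have reg: "ract y g \<in> regular" "ract y h \<in> regular" if "y \<in> regular" for y
    using that P V by (auto simp: regular_iff h h')
  have "homeomorphism regular regular (\<lambda>x. ract x g) (\<lambda>x. ract x h)"
    using reg by (intro homeomorphismI continuous_on_ract) (auto simp: gh)
  then have "connected_component_set regular (ract y0 g) = (\<lambda>x. ract x g) ` connected_component_set regular y0"
    using y0(1) by (rule connected_component_set_homeomorphism)
  moreover have inj: "inj (\<lambda>x. ract x g)" by (metis gh(1) injI)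
  moreover have "(\<lambda>x. ract x g) ` P = P" 
  proof safe
    fix y assume "y \<in> P"
    then show "y \<in> (\<lambda>x. ract x g) ` P" using P(2) gh(2) by (intro image_eqI[of _ _ "ract y h"]) simp_all
  qed (rule P(1))
  ultimately have "(\<lambda>x. ract x g) ` D = P \<inter> closure (connected_component_set regular (ract y0 g))"
    by (simp add: y0(2) image_Int closure_injective_linear_image[OF linear_ract])
  then show ?thesis using reg y0(1) by (auto simp: chamber_iff)
qed

end

section \<open>A well-rounded point in every chamber\<close>

context hyperbolic_cone
begin

text \<open>A multiple t l in the dual lattice is measured by the natural number |disc * t * l_i|
  for a coordinate l_i that is not zero. Such numbers have a least element, and it is positive
  because t = 0 is excluded.\<close>

lemma primitive_on_ray:
  assumes e: "e \<noteq> 0" "e = r *\<^sub>R l" "l \<in> lattice" "r > 0"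
  obtains \<alpha> where "\<alpha> > 0" "\<alpha> *\<^sub>R e \<in> dual_lattice Q"
    "\<And>a. a \<noteq> 0 \<Longrightarrow> a *\<^sub>R (\<alpha> *\<^sub>R e) \<in> dual_lattice Q \<Longrightarrow> \<bar>a\<bar> \<ge> 1"
proof -
  have "l \<noteq> 0" using e by auto
  then obtain i where i: "l $ i \<noteq> 0" by (auto simp: vec_eq_iff)
  define R where "R n \<longleftrightarrow> (\<exists>t. t \<noteq> 0 \<and> t *\<^sub>R l \<in> dual_lattice Q \<and> real n = \<bar>disc * (t * l $ i)\<bar>)" for n
  have R: "\<exists>n. real n = \<bar>disc * (t * l $ i)\<bar> \<and> R n" if "t \<noteq> 0" "t *\<^sub>R l \<in> dual_lattice Q" for t
  proof -
    have "disc * (t * l $ i) \<in> \<int>" using disc_dual[OF that(2)] by (simp add: lattice_def mult.assoc)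
    then obtain k :: int where "disc * (t * l $ i) = of_int k" by (auto elim: Ints_cases)
    then have "real (nat \<bar>k\<bar>) = \<bar>disc * (t * l $ i)\<bar>" by simp
    then show ?thesis using that unfolding R_def by blast
  qed
  have "\<exists>n. R n" using R[of 1] e(3) lattice_subset_dual by auto
  then have "R (LEAST n. R n)" by (rule LeastI_ex)
  then obtain t where t: "t \<noteq> 0" "t *\<^sub>R l \<in> dual_lattice Q" "real (LEAST n. R n) = \<bar>disc * (t * l $ i)\<bar>"
    unfolding R_def by blast
  have dual_minus: "- v \<in> dual_lattice Q" if "v \<in> dual_lattice Q" for v
    using that by (simp add: dual_lattice_def bform_simps)
  show thesis
  proof
    show "\<bar>t\<bar> / r > 0" using t e by simp
    have eq: "(\<bar>t\<bar> / r) *\<^sub>R e = \<bar>t\<bar> *\<^sub>R l" using e by simp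
    show "(\<bar>t\<bar> / r) *\<^sub>R e \<in> dual_lattice Q"
      unfolding eq using t(2) dual_minus[OF t(2)] by (cases "t > 0") auto
    fix a :: real assume a: "a \<noteq> 0" "a *\<^sub>R ((\<bar>t\<bar> / r) *\<^sub>R e) \<in> dual_lattice Q"
    have "(a * \<bar>t\<bar>) *\<^sub>R l \<in> dual_lattice Q" using a(2) unfolding eq by simp
    from R[OF _ this] a(1) t(1) obtain n where n: "real n = \<bar>disc * ((a * \<bar>t\<bar>) * l $ i)\<bar>" "R n" by auto
    have "(LEAST n. R n) \<le> n" using n(2) by (rule Least_le)
    then have "\<bar>disc * (t * l $ i)\<bar> \<le> \<bar>disc * ((a * \<bar>t\<bar>) * l $ i)\<bar>" using t(3) n(1) by linarith
    then have "1 * (disc * \<bar>t\<bar> * \<bar>l $ i\<bar>) \<le> \<bar>a\<bar> * (disc * \<bar>t\<bar> * \<bar>l $ i\<bar>)"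
      using disc_pos by (simp add: abs_mult mult_ac)
    moreover have "disc * \<bar>t\<bar> * \<bar>l $ i\<bar> > 0" using disc_pos t i by simp
    ultimately show "\<bar>a\<bar> \<ge> 1" by (rule mult_right_le_imp_le)
  qed
qed

end

locale chamber_geometry = chamber_family Q P V c for Q :: "real^'n^'n" and P V c +
  fixes D :: "(real^'n) set"
  assumes D: "chamber Q P V D"
    and cusps: "\<And>x. x \<in> closure D \<Longrightarrow> x \<noteq> 0 \<Longrightarrow> ip x x = 0 \<Longrightarrow> \<exists>r>0. \<exists>l\<in>lattice. x = r *\<^sub>R l"
begin

section \<open>Faces of minimal dimension\<close>

definition face_space :: "real^'n \<Rightarrow> (real^'n) set" where
  "face_space x = {y. \<forall>w\<in>walls x. ip y w = 0}"

lemma face_space_simps: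
  "y \<in> face_space x \<Longrightarrow> z \<in> face_space x \<Longrightarrow> y + z \<in> face_space x"
  "y \<in> face_space x \<Longrightarrow> z \<in> face_space x \<Longrightarrow> y - z \<in> face_space x"
  "y \<in> face_space x \<Longrightarrow> a *\<^sub>R y \<in> face_space x"
  by (auto simp: face_space_def bform_simps)

lemma subspace_face_space: "subspace (face_space x)"
  by (auto simp: subspace_def face_space_def bform_simps)

lemma D_subset: "D \<subseteq> P"
  using D by (auto simp: chamber_def)

lemma D_nonempty: "D \<noteq> {}"
proof -
  obtain y where y: "y \<in> regular" "D = P \<inter> closure (connected_component_set regular y)"
    using D by (auto simp: chamber_iff)
  then have "y \<in> D" using closure_subset by (force simp: regular_iff)
  then show ?thesis by blast
qed

text \<open>A face is represented by a point on it. The walls through the point cut out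
  \<open>face_space\<close>, so maximal rank of the walls means minimal dimension of the
  face.\<close>

definition minimal_face :: "real^'n \<Rightarrow> bool" where
  "minimal_face x \<longleftrightarrow> x \<in> D \<and> (\<forall>y\<in>D. dim (walls y) \<le> dim (walls x))"

lemma minimal_face_exists: "\<exists>x. minimal_face x"
proof -
  obtain x0 where "x0 \<in> D" using D_nonempty by blast
  then have "\<exists>x. x \<in> D \<and> (\<forall>y. y \<in> D \<longrightarrow> dim (walls y) \<le> dim (walls x))"
    by (rule ex_has_greatest_nat[where b = "Suc CARD('n)"]) (simp add: less_Suc_eq_le dim_subset_UNIV_cart)
  then show ?thesis by (auto simp: minimal_face_def)
qed

text \<open>The walls through z include those through x, and maximality of the rank makes both spans
  equal. So no new linear condition can appear inside the face.\<close>

lemma walls_on_minimal_face: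
  assumes x: "minimal_face x" and z: "z \<in> D" "z \<in> face_space x" and y: "y \<in> face_space x" and v: "v \<in> walls z"
  shows "ip y v = 0"
proof -
  have sub: "walls x \<subseteq> walls z" using z by (auto simp: walls_def face_space_def)
  have "span (walls x) = span (walls z)"
    using x z sub by (intro dim_eq_span) (auto simp: minimal_face_def)
  then have "v \<in> span (walls x)" using v span_base by blast
  moreover have "subspace {v. ip y v = 0}" by (auto simp: subspace_def bform_simps)
  moreover have "walls x \<subseteq> {v. ip y v = 0}" using y by (auto simp: face_space_def)
  ultimately show ?thesis using span_minimal by blast
qed

text \<open>The part of \<open>?W\<close> in the chamber is non-empty, closed and open in the
  connected set \<open>?W\<close>, hence all of it. Minimality is what gives openness.\<close>

lemma minimal_face_subset:
  assumes x: "minimal_face x"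
  shows "face_space x \<inter> P \<subseteq> D"
proof -
  let ?W = "face_space x \<inter> P"
  obtain y0 where y0: "y0 \<in> regular" and Dy: "D = P \<inter> closure (connected_component_set regular y0)"
    using D by (auto simp: chamber_iff)
  let ?C = "connected_component_set regular y0"
  have "convex ?W" by (intro convex_Int convex_P subspace_imp_convex subspace_face_space)
  then have "connected ?W" by (rule convex_connected)
  moreover have "closedin (top_of_set ?W) (?W \<inter> D)"
  proof -
    have "?W \<inter> D = ?W \<inter> closure ?C" using Dy by blast
    then show ?thesis by (simp add: closedin_closed_Int)
  qed
  moreover have "openin (top_of_set ?W) (?W \<inter> D)"
    unfolding openin_contains_ball
  proof safe
    fix z assume z: "z \<in> face_space x" "z \<in> P" "z \<in> D"
    obtain \<delta> where \<delta>: "isolating z \<delta>" using isolating_exists[OF z(2)] by blast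
    \<comment> \<open>Both z and y are orthogonal to all walls through z, so translation by y - z
      changes no sign there: points of C close to z go to points of C close to y.\<close>
    have "y \<in> closure ?C" if y: "y \<in> ball z \<delta>" "y \<in> face_space x" for y
      unfolding closure_approachable
    proof safe
      fix e :: real assume "e > 0"
      \<comment> \<open>Small enough to keep both u and its translate inside the isolating
        ball.\<close>
      define \<eta> where "\<eta> = min e (\<delta> - dist z y)"
      have "\<eta> > 0" using \<open>e > 0\<close> y by (simp add: \<eta>_def)
      moreover have "z \<in> closure ?C" using z Dy by blast
      ultimately obtain u where u: "u \<in> ?C" "dist u z < \<eta>" unfolding closure_approachable by blast
      define u' where "u' = u + (y - z)"
      have yz: "ip (y - z) v = 0" if "v \<in> walls z" for v
        using walls_on_minimal_face[OF x z(3) z(1) y(2) that] walls_on_minimal_face[OF x z(3) z(1) z(1) that]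
        by (simp add: bform_simps)
      have ur: "u \<in> regular" using u(1) by (metis connected_component_in mem_Collect_eq)
      have "connected_component regular u u'"
      proof (rule same_component[OF \<delta> _ _ ur])
        have "\<eta> \<le> \<delta>" using zero_le_dist[of z y] unfolding \<eta>_def by linarith
        then show "u \<in> ball z \<delta>" using u(2) by (simp add: dist_commute)
        have "dist z u' \<le> dist z y + dist u z"
          unfolding u'_def dist_norm using norm_triangle_ineq[of "z - y" "z - u"] by (simp add: norm_minus_commute algebra_simps)
        moreover have "\<eta> \<le> \<delta> - dist z y" by (simp add: \<eta>_def)
        ultimately show "u' \<in> ball z \<delta>" using u(2) by simp
        fix v assume v: "v \<in> walls z"
        have "ip u v \<noteq> 0" using ur v by (auto simp: regular_iff walls_def)
        moreover have "ip u' v = ip u v" using yz[OF v] by (simp add: u'_def bform_add_left)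
        ultimately show "0 < ip u v * ip u' v" by (simp add: zero_less_mult_iff linorder_neq_iff[symmetric])
      qed
      then have "u' \<in> ?C" using u(1) by (auto intro: connected_component_trans)
      moreover have "dist u' y < e" using u(2) by (simp add: u'_def dist_norm \<eta>_def algebra_simps)
      ultimately show "\<exists>u\<in>?C. dist u y < e" by blast
    qed
    then have "ball z \<delta> \<inter> ?W \<subseteq> ?W \<inter> D" using Dy by blast
    then show "\<exists>\<delta>>0. ball z \<delta> \<inter> ?W \<subseteq> ?W \<inter> D" using \<delta> by (auto simp: isolating_def)
  qed
  ultimately have "?W \<inter> D = {} \<or> ?W \<inter> D = ?W" unfolding connected_clopen by blast
  moreover have "x \<in> ?W \<inter> D" using x D_subset by (auto simp: minimal_face_def face_space_def walls_def)
  ultimately show ?thesis by blast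
qed

text \<open>At a point x' orthogonal to a wall w, the majorant of w is just -w^2 < c. By
  Cauchy-Schwarz the squared product of v with w is then at most gap * c, less than the square of
  the least non-zero value 1/disc.\<close>

lemma short_dual_vector:
  assumes x': "x' \<in> face_space x" "ip x' x' = 1"
    and v: "v \<in> dual_lattice Q" "majorant x' v v < gap"
  shows "v \<in> face_space x" "ip v v = 0"
proof -
  show "ip v v = 0"
  proof (rule ccontr)
    assume "ip v v \<noteq> 0"
    then have "1 / disc \<le> \<bar>ip v v\<bar>" by (rule dual_ip_ge[OF v(1) v(1)])
    then show False using majorant_ge(2)[OF x'(2), of v] v(2) gap(2) by linarith
  qed
  show "v \<in> face_space x"
    unfolding face_space_def
  proof safe
    fix w assume w: "w \<in> walls x"
    have wd: "w \<in> dual_lattice Q" "- ip w w < c" using w V V_bound by (auto simp: walls_def)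
    have "majorant x' w w = - ip w w" using x'(1) w by (simp add: majorant_def face_space_def)
    then have mw: "majorant x' w w < c" using wd by simp
    show "ip v w = 0"
    proof (rule ccontr)
      assume "ip v w \<noteq> 0"
      then have "1 / disc \<le> \<bar>ip v w\<bar>" by (rule dual_ip_ge[OF v(1) wd(1)])
      also have "\<dots> \<le> mnorm x' v * mnorm x' w" by (rule ip_bound[OF x'(2)])
      finally have "(1 / disc)\<^sup>2 \<le> (mnorm x' v * mnorm x' w)\<^sup>2" using disc_pos by (intro power_mono) auto
      also have "\<dots> = majorant x' v v * majorant x' w w" by (simp add: power_mult_distrib mnorm_sq[OF x'(2)])
      also have "\<dots> \<le> gap * c" using v(2) mw majorant_ge(3)[OF x'(2)] gap(1) by (intro mult_mono) auto
      finally show False using gap(3) by simp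
    qed
  qed
qed

text \<open>For t > 0 the vectors u + t x1 lie in W \<inter> P, hence in D, and they tend to u. The
  condition ip x1 u > 0 puts u on the boundary of P and not of the opposite cone.\<close>

lemma cusp_of_face:
  assumes x: "minimal_face x" and x1: "x1 \<in> face_space x \<inter> P"
    and u: "u \<in> face_space x" "ip u u = 0" "ip x1 u > 0"
  obtains r l where "r > 0" "l \<in> lattice" "u = r *\<^sub>R l"
proof -
  have x1P: "ip x1 x1 > 0" using x1 P_pos by blast
  have "u \<in> closure D"
    unfolding closure_approachable
  proof safe
    fix e :: real assume e: "e > 0"
    define t where "t = e / (2 * norm x1)"
    have n: "norm x1 > 0" using x1 P_nonzero by auto
    then have t: "t > 0" using e by (simp add: t_def)
    have "ip (u + t *\<^sub>R x1) (u + t *\<^sub>R x1) = 2 * t * ip x1 u + t\<^sup>2 * ip x1 x1"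
      using u ip_commute[of u x1] by (simp add: bform_simps power2_eq_square algebra_simps)
    also have "\<dots> > 0" using t u x1P by (intro add_pos_pos) auto
    finally have "ip (u + t *\<^sub>R x1) (u + t *\<^sub>R x1) > 0" .
    moreover have "ip x1 (u + t *\<^sub>R x1) > 0" using x1P t u by (simp add: bform_simps add_pos_pos)
    ultimately have "u + t *\<^sub>R x1 \<in> P" using x1 P_I by blast
    moreover have "u + t *\<^sub>R x1 \<in> face_space x" using u x1 by (auto intro!: face_space_simps)
    ultimately have "u + t *\<^sub>R x1 \<in> D" using minimal_face_subset[OF x] by blast
    moreover have "dist (u + t *\<^sub>R x1) u < e" using t n e by (simp add: dist_norm t_def)
    ultimately show "\<exists>y\<in>D. dist y u < e" by blast
  qed
  moreover have "u \<noteq> 0" using u by (auto simp: bform_simps)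
  ultimately show thesis using cusps u(2) that by blast
qed

text \<open>x1, y and z span a space of signature (1, 2). Its isotropic vectors with product 1 with
  x1 form a circle, of which \<open>e\<close> traces one half. Each of them is a lattice vector l
  rescaled by 1 / ip x1 l, a factor that l determines, so they would be countable.\<close>

lemma minimal_face_no_conic:
  assumes x: "minimal_face x" and x1: "x1 \<in> face_space x \<inter> P" "ip x1 x1 = 1"
    and y: "y \<in> face_space x" "ip x1 y = 0" "ip y y = - 1"
    and z: "z \<in> face_space x" "ip x1 z = 0" "ip y z = 0" "ip z z = - 1"
  shows False
proof -
  define e where "e t = x1 + t *\<^sub>R y + sqrt (1 - t\<^sup>2) *\<^sub>R z" for t
  have x1y: "ip y x1 = 0" "ip z x1 = 0" "ip z y = 0"
    using y z ip_commute by metis+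
  have "e t \<in> (\<lambda>l. (1 / ip x1 l) *\<^sub>R l) ` lattice" if t: "t \<in> {-1..1}" for t
  proof -
    have "t\<^sup>2 \<le> 1" using t by (simp add: abs_square_le_1 abs_le_iff)
    then have iso: "ip (e t) (e t) = 0"
      using x1 y z x1y by (simp add: e_def bform_simps power2_eq_square flip: real_sqrt_mult)
    have one: "ip x1 (e t) = 1" using x1 y z by (simp add: e_def bform_simps)
    have "e t \<in> face_space x" using x1 y z by (auto simp: e_def intro!: face_space_simps)
    from cusp_of_face[OF x x1(1) this iso] one obtain r l where rl: "r > 0" "l \<in> lattice" "e t = r *\<^sub>R l"
      by (metis zero_less_one)
    have r: "r * ip x1 l = 1" using one unfolding rl(3) by (simp add: bform_simps)
    then have "ip x1 l \<noteq> 0" by auto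
    with r have "1 / ip x1 l = r" by (simp add: field_simps)
    then show ?thesis using rl by (intro image_eqI[of _ _ l]) simp_all
  qed
  then have "e ` {-1..1} \<subseteq> (\<lambda>l. (1 / ip x1 l) *\<^sub>R l) ` lattice" by blast
  then have "countable (e ` {-1..1})" by (rule countable_subset) (intro countable_image countable_lattice)
  moreover have "inj_on e {-1..1}"
  proof (rule inj_on_inverseI)
    show "- ip y (e t) = t" if "t \<in> {-1..1}" for t
      using y z x1y by (simp add: e_def bform_simps)
  qed
  ultimately have "countable {-1..1::real}" by (simp add: countable_image_inj_eq)
  then show False using uncountable_closed_interval[of "-1" "1::real"] by simp
qed

proposition well_rounded_point: "\<exists>x\<in>D. well_rounded gap x"
proof -
  obtain x where x: "minimal_face x" using minimal_face_exists by blast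
  let ?W = "face_space x"
  have xD: "x \<in> D" and xP: "x \<in> P" using x D_subset by (auto simp: minimal_face_def)
  have xW: "x \<in> ?W" by (simp add: face_space_def walls_def)
  define x1 where "x1 = (1 / sqrt (ip x x)) *\<^sub>R x"
  have x1: "x1 \<in> ?W \<inter> P" "ip x1 x1 = 1"
    using normalize[OF xP] face_space_simps(3)[OF xW] by (auto simp: x1_def)
  show ?thesis
  proof (cases "\<exists>u\<in>?W. u \<noteq> 0 \<and> ip u u = 0")
    case False
    have "well_rounded gap x1"
      unfolding well_rounded_def
    proof (intro conjI ballI impI)
      fix v assume v: "v \<in> dual_lattice Q" "v \<noteq> 0"
      then show "gap \<le> majorant x1 v v"
        using short_dual_vector[of x1 x v] x1 False by force
    qed (rule x1)
    then show ?thesis using minimal_face_subset[OF x] x1 by blast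
  next
    case True
    then obtain u where u: "u \<in> ?W" "u \<noteq> 0" "ip u u = 0" by blast
    \<comment> \<open>The factor s is kept so that a further orthogonality relation of
      \<open>y0\<close> passes to its normalisation.\<close>
    have nrm: "\<exists>y\<in>?W. ip x1 y = 0 \<and> ip y y = - 1 \<and> (\<exists>s. y = s *\<^sub>R y0)"
      if y0: "y0 \<in> ?W" "ip x1 y0 = 0" "y0 \<noteq> 0" for y0
    proof -
      have "ip y0 y0 < 0" using perp_neg[OF _ y0(2,3)] x1 by simp
      then show ?thesis using y0
        by (intro bexI[of _ "(1 / sqrt (- ip y0 y0)) *\<^sub>R y0"] conjI exI)
           (auto simp: bform_simps face_space_simps)
    qed
    define y0 where "y0 = u - ip x1 u *\<^sub>R x1"
    have "y0 \<in> ?W" "ip x1 y0 = 0" using u x1 by (auto simp: y0_def bform_simps intro!: face_space_simps)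
    moreover have "y0 \<noteq> 0"
    proof
      assume "y0 = 0"
      then have eq: "u = ip x1 u *\<^sub>R x1" by (simp add: y0_def)
      then have "ip u u = ip x1 u * ip x1 u" using x1(2) by (metis bform_scale_left)
      then show False using u eq by simp
    qed
    ultimately obtain y where y: "y \<in> ?W" "ip x1 y = 0" "ip y y = - 1" using nrm by blast
    have yx: "ip y x1 = 0" using y ip_commute by metis
    \<comment> \<open>The minus sign reflects y^2 = -1. A non-zero remainder would be the third
      orthogonal direction that the conic argument forbids, so W is the plane of x1 and y.\<close>
    have span: "v = ip x1 v *\<^sub>R x1 - ip y v *\<^sub>R y" if v: "v \<in> ?W" for v
    proof (rule ccontr)
      assume ne: "v \<noteq> ip x1 v *\<^sub>R x1 - ip y v *\<^sub>R y"
      define z0 where "z0 = v - (ip x1 v *\<^sub>R x1 - ip y v *\<^sub>R y)"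
      have z0: "z0 \<in> ?W" "ip x1 z0 = 0" "ip y z0 = 0" "z0 \<noteq> 0"
        using v x1 y yx ne by (auto simp: z0_def bform_simps intro!: face_space_simps)
      then obtain z s where "z \<in> ?W" "ip x1 z = 0" "ip z z = - 1" "z = s *\<^sub>R z0" using nrm by blast
      then show False using minimal_face_no_conic[OF x x1 y, of z] z0 by (simp add: bform_simps)
    qed
    define e e' where "e = x1 + y" and "e' = x1 - y"
    have e: "e \<in> ?W" "ip e e = 0" "ip x1 e = 1" "e' \<in> ?W" "ip e' e' = 0" "ip x1 e' = 1" "ip e e' = 2"
      using x1 y yx by (auto simp: e_def e'_def bform_simps intro!: face_space_simps)
    have e0: "e \<noteq> 0" "e' \<noteq> 0" using e by (auto simp: bform_simps)
    obtain r l where rl: "r > 0" "l \<in> lattice" "e = r *\<^sub>R l"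
      using cusp_of_face[OF x x1(1) e(1,2)] e(3) by auto
    obtain r' l' where rl': "r' > 0" "l' \<in> lattice" "e' = r' *\<^sub>R l'"
      using cusp_of_face[OF x x1(1) e(4,5)] e(6) by auto
    \<comment> \<open>The rays are known to contain vectors of L, but primitivity is taken in the
      dual lattice, since that is where well-roundedness is tested.\<close>
    obtain \<alpha> where \<alpha>: "\<alpha> > 0" "\<alpha> *\<^sub>R e \<in> dual_lattice Q"
      "\<And>a. a \<noteq> 0 \<Longrightarrow> a *\<^sub>R (\<alpha> *\<^sub>R e) \<in> dual_lattice Q \<Longrightarrow> \<bar>a\<bar> \<ge> 1"
      using primitive_on_ray[OF e0(1) rl(3,2,1)] by metis
    obtain \<beta> where \<beta>: "\<beta> > 0" "\<beta> *\<^sub>R e' \<in> dual_lattice Q"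
      "\<And>a. a \<noteq> 0 \<Longrightarrow> a *\<^sub>R (\<beta> *\<^sub>R e') \<in> dual_lattice Q \<Longrightarrow> \<bar>a\<bar> \<ge> 1"
      using primitive_on_ray[OF e0(2) rl'(3,2,1)] by metis
    define f f' \<kappa> where "f = \<alpha> *\<^sub>R e" and "f' = \<beta> *\<^sub>R e'" and "\<kappa> = ip f f'"
    have f: "f \<in> ?W" "f' \<in> ?W" "ip f f = 0" "ip f' f' = 0" "ip x1 f = \<alpha>" "ip x1 f' = \<beta>"
      using e by (auto simp: f_def f'_def bform_simps face_space_simps)
    have \<kappa>: "\<kappa> > 0" using e \<alpha> \<beta> by (simp add: \<kappa>_def f_def f'_def bform_simps)
    have ff: "ip f f' = \<kappa>" "ip f' f = \<kappa>" using ip_commute by (auto simp: \<kappa>_def)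
    have "1 / disc \<le> \<kappa>" using dual_ip_ge[OF \<alpha>(2) \<beta>(2)] \<kappa> by (simp add: \<kappa>_def f_def f'_def)
    then have gap\<kappa>: "gap < \<kappa>" using gap(2) by simp
    \<comment> \<open>The point of the edge at which both primitive isotropic end vectors have equal majorant norm.\<close>
    define x' where "x' = (1 / sqrt (2 * \<kappa>)) *\<^sub>R (f + f')"
    have x'W: "x' \<in> ?W" using f by (auto simp: x'_def intro!: face_space_simps)
    have x'1: "ip x' x' = 1" using f ff \<kappa> by (simp add: x'_def bform_simps)
    have "ip x1 x' > 0" using f \<alpha> \<beta> \<kappa> by (simp add: x'_def bform_simps)
    then have x'P: "x' \<in> P" using P_I[of x1 x'] x1(1) x'1 by simp
    \<comment> \<open>Both f and f' have product sqrt (\<kappa> / 2) with x' and are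
      isotropic.\<close>
    have maj: "majorant x' v v = a\<^sup>2 * \<kappa>" if "v = a *\<^sub>R f \<or> v = a *\<^sub>R f'" for v a
      using that f ff \<kappa> by (auto simp: majorant_def x'_def bform_simps power2_eq_square)
    have "well_rounded gap x'"
      unfolding well_rounded_def
    proof (intro conjI ballI impI)
      fix v assume v: "v \<in> dual_lattice Q" "v \<noteq> 0"
      show "gap \<le> majorant x' v v"
      proof (rule ccontr)
        assume less: "\<not> gap \<le> majorant x' v v"
        then have vW: "v \<in> ?W" "ip v v = 0" using short_dual_vector[OF x'W x'1 v(1)] by auto
        define p q where "p = ip x1 v" and "q = - ip y v"
        have vpq: "v = p *\<^sub>R x1 + q *\<^sub>R y" using span[OF vW(1)] by (simp add: p_def q_def)
        \<comment> \<open>Coordinates with respect to f and f', in which the square of v is 2 a b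
          \<kappa>; isotropy forces one of them to vanish.\<close>
        define a b where "a = (p + q) / (2 * \<alpha>)" and "b = (p - q) / (2 * \<beta>)"
        have "v = ((p + q) / 2) *\<^sub>R e + ((p - q) / 2) *\<^sub>R e'"
          unfolding vpq e_def e'_def by (simp add: vec_eq_iff field_simps)
        then have vab: "v = a *\<^sub>R f + b *\<^sub>R f'" using \<alpha>(1) \<beta>(1) by (simp add: a_def b_def f_def f'_def)
        have "ip v v = 2 * (a * b * \<kappa>)" unfolding vab using f ff by (simp add: bform_simps)
        then have "a = 0 \<or> b = 0" using vW \<kappa> by simp
        then have "v = a *\<^sub>R f \<or> v = b *\<^sub>R f'" using vab by auto
        then obtain t where t: "v = t *\<^sub>R f \<or> v = t *\<^sub>R f'" by blast
        then have "t \<noteq> 0" using v(2) by auto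
        then have "\<bar>t\<bar> \<ge> 1" using t v(1) \<alpha>(3) \<beta>(3) by (auto simp: f_def f'_def)
        then have "t\<^sup>2 \<ge> 1" by (simp add: abs_le_square_iff[of 1, simplified])
        then have "\<kappa> \<le> t\<^sup>2 * \<kappa>" using \<kappa> by simp
        then show False using less maj[OF t] gap\<kappa> by simp
      qed
    qed (rule x'1)
    then show ?thesis using minimal_face_subset[OF x] x'W x'P by blast
  qed
qed

end

section \<open>Finiteness of the congruence classes\<close>

text \<open>Allows a chamber to be replaced by a G-translate without changing its class.\<close>

lemma congruent_image_iff:
  assumes G: "is_subgroup G (orth_plus Q P)" and g: "g \<in> G" and D': "D' = (\<lambda>x. ract x g) ` D"
  shows "congruent G D X \<longleftrightarrow> congruent G D' X"
proof -
  have inv: "matrix_inv g \<in> G" "g ** matrix_inv g = mat 1"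
  proof -
    show "matrix_inv g \<in> G" using G g by (auto simp: is_subgroup_def)
    obtain h where h: "g ** h = mat 1" "h ** g = mat 1"
      using G g by (auto simp: is_subgroup_def orth_plus_def invertible_def)
    then show "g ** matrix_inv g = mat 1" using matrix_inv_eqI[OF h(2)] by simp
  qed
  have mult: "a ** b \<in> G" if "a \<in> G" "b \<in> G" for a b using G that by (auto simp: is_subgroup_def)
  have "D = (\<lambda>x. ract x (matrix_inv g)) ` D'"
    by (simp add: D' image_image inv(2) ract_mat_1 flip: ract_mult)
  then have "(\<lambda>x. ract x h) ` D = (\<lambda>x. ract x (matrix_inv g ** h)) ` D'" for h
    by (simp add: image_image ract_mult)
  moreover have "(\<lambda>x. ract x h) ` D' = (\<lambda>x. ract x (g ** h)) ` D" for h
    by (simp add: D' image_image ract_mult)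
  ultimately show ?thesis
    unfolding congruent_def using mult g inv(1) by metis
qed

theorem theorem3p7:
  fixes Q :: "real^'n^'n" and P :: "(real^'n) set"
    and G :: "(real^'n^'n) set" and V :: "(real^'n) set"
  assumes L: "even_hyperbolic_lattice Q"
    and P: "positive_cone Q P"
    and G: "is_subgroup G (orth_plus Q P)" "finite_index G (orth_plus Q P)"
    and V: "V \<subseteq> neg_vectors Q \<inter> dual_lattice Q"
    and V1: "\<exists>c>0. \<forall>v\<in>V. - bform Q v v < c"
    and V2: "\<forall>g\<in>G. \<forall>v\<in>V. ract v g \<in> V"
    and V3: "\<forall>D. chamber Q P V D \<longrightarrow> (\<exists>\<Delta>. finite \<Delta> \<and> defining_set Q P D \<Delta>)"
    and V4: "\<forall>D. chamber Q P V D \<longrightarrow>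
               (\<forall>x\<in>closure D. x \<noteq> 0 \<and> bform Q x x = 0 \<longrightarrow>
                  (\<exists>r>0. \<exists>l\<in>lattice. x = r *\<^sub>R l))"
  shows "finite (congruence_classes Q P V G)"
proof -
  obtain c where c: "c > 0" "\<forall>v\<in>V. - bform Q v v < c" using V1 by blast
  interpret hyperbolic_cone Q P by unfold_locales (fact L P)+
  interpret chamber_family Q P V c by unfold_locales (use V c in auto)
  have point: "\<exists>x\<in>D. well_rounded gap x" if D: "chamber Q P V D" for D
  proof -
    interpret chamber_geometry Q P V c D
      by unfold_locales (use D V4 in auto)
    show ?thesis by (rule well_rounded_point)
  qed
  obtain K where K: "compact K" "K \<subseteq> P"
    "\<And>x. x \<in> P \<Longrightarrow> well_rounded gap x \<Longrightarrow> \<exists>g\<in>orth_plus Q P. ract x g \<in> K"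
    using well_rounded_compact[OF gap(1)] by blast
  have orth: "matrix_inv g ** g = mat 1" "g ** matrix_inv g = mat 1"
    "\<And>y z. ip (ract y g) (ract z g) = ip y z" "(\<lambda>x. ract x g) ` P = P"
    "\<And>y. y \<in> P \<Longrightarrow> ract y (matrix_inv g) \<in> P" if g: "g \<in> orth_plus Q P" for g
  proof -
    obtain h where h: "g ** h = mat 1" "h ** g = mat 1"
      using g by (auto simp: orth_plus_def invertible_def)
    have inv: "matrix_inv g = h" by (rule matrix_inv_eqI) fact
    show "matrix_inv g ** g = mat 1" "g ** matrix_inv g = mat 1" unfolding inv by fact+
    show "\<And>y z. ip (ract y g) (ract z g) = ip y z" and im: "(\<lambda>x. ract x g) ` P = P"
      using g by (auto simp: orth_plus_def)
    show "ract y (matrix_inv g) \<in> P" if "y \<in> P" for y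
    proof -
      have "y \<in> (\<lambda>x. ract x g) ` P" unfolding im by (rule that)
      then obtain z where "z \<in> P" "y = ract z g" by (elim imageE)
      then show ?thesis by (simp add: inv h ract_mat_1 flip: ract_mult)
    qed
  qed
  have GO: "G \<subseteq> orth_plus Q P" using G(1) by (simp add: is_subgroup_def)
  let ?coset = "\<lambda>g. (\<lambda>h. h ** g) ` G"
  have "finite (?coset ` orth_plus Q P)" using G(2) by (simp add: finite_index_def)
  \<comment> \<open>R is a finite set of representatives of the right cosets of G in O^+(L).\<close>
  from finite_subset_image[OF this, of ?coset "orth_plus Q P"] obtain R where R: "R \<subseteq> orth_plus Q P" "finite R"
    "?coset ` orth_plus Q P = ?coset ` R"
    by auto
  have coset: "\<exists>h\<in>G. \<exists>r\<in>R. g = h ** r" if g: "g \<in> orth_plus Q P" for g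
  proof -
    have "?coset g \<in> ?coset ` R" unfolding R(3)[symmetric] using g by (rule imageI)
    then obtain r where r: "r \<in> R" "?coset g = ?coset r" by (elim imageE)
    have "mat 1 ** g \<in> ?coset g" using G(1) by (intro imageI) (simp add: is_subgroup_def)
    then have "g \<in> ?coset r" unfolding r(2) by simp
    then show ?thesis using r(1) by blast
  qed
  \<comment> \<open>If g = h r moves x into K, then h alone moves x into the translate of K by the
    inverse of r, since the action is from the right. So finitely many translates of K serve the
    smaller group G.\<close>
  define K' where "K' = (\<Union>r\<in>R. (\<lambda>x. ract x (matrix_inv r)) ` K)"
  have "compact K'"
    unfolding K'_def using R(2) K(1)
    by (intro compact_UN compact_continuous_image continuous_on_ract) auto
  moreover have "K' \<subseteq> P" using orth(5) R(1) K(2) by (auto simp: K'_def)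
  ultimately have fin: "finite {D. chamber Q P V D \<and> D \<inter> K' \<noteq> {}}" by (rule finite_chambers_compact)
  have "congruence_classes Q P V G \<subseteq>
    (\<lambda>D. {D'. chamber Q P V D' \<and> congruent G D D'}) ` {D. chamber Q P V D \<and> D \<inter> K' \<noteq> {}}"
    unfolding congruence_classes_def
  proof (rule image_subsetI)
    fix D assume "D \<in> {D. chamber Q P V D}"
    then have D: "chamber Q P V D" by simp
    obtain x where x: "x \<in> D" "well_rounded gap x" using point[OF D] by blast
    have "x \<in> P" using x D by (auto simp: chamber_def)
    from K(3)[OF this x(2)] obtain g where g: "g \<in> orth_plus Q P" "ract x g \<in> K" by blast
    obtain h r where hr: "h \<in> G" "r \<in> R" "g = h ** r" using coset[OF g(1)] by blast
    define D' where "D' = (\<lambda>x. ract x h) ` D"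
    have hO: "h \<in> orth_plus Q P" and rO: "r \<in> orth_plus Q P" using hr GO R by auto
    have hi: "matrix_inv h \<in> G" using G(1) hr by (simp add: is_subgroup_def)
    have "ract (ract x g) (matrix_inv r) = ract x h"
      by (simp add: hr(3) orth(2)[OF rO] flip: ract_mult matrix_mul_assoc)
    then have "ract x h \<in> K'" using g(2) hr(2) unfolding K'_def by (metis UN_I imageI)
    then have "D' \<inter> K' \<noteq> {}" using x(1) by (auto simp: D'_def)
    moreover have "chamber Q P V D'"
      unfolding D'_def
      by (rule chamber_image[OF orth(3)[OF hO] orth(1)[OF hO] _ orth(5)[OF hO] _ _ D])
        (use orth(4)[OF hO] V2 hr(1) hi in auto)
    moreover have "{X. chamber Q P V X \<and> congruent G D X} = {X. chamber Q P V X \<and> congruent G D' X}"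
      using congruent_image_iff[OF G(1) hr(1) D'_def] by simp
    ultimately show "{X. chamber Q P V X \<and> congruent G D X} \<in>
      (\<lambda>D. {D'. chamber Q P V D' \<and> congruent G D D'}) ` {D. chamber Q P V D \<and> D \<inter> K' \<noteq> {}}"
      by blast
  qed
  then show ?thesis using fin by (rule finite_subset[OF _ finite_imageI])
qed

end
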